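(* There exist explicit positive constants $A$ and $B$ with the following property. For every non-increasing function $\psi:\mathbb{R}_+\to\mathbb{R}_+$ with $\psi(1)\leq A$ there is an uncountable set of vectors $\boldsymbol\alpha\in\mathbb{R}^2$ such that for all $\mathbf x\in\mathbb{Z}^2\setminus\{\mathbf 0\}$ \[ \|\langle\boldsymbol\alpha,\mathbf x\rangle\|\geq \frac{\psi(|\mathbf x|)}{|\mathbf x|^2}\bigl(1-B\psi(|\mathbf x|)\bigr), \] while the inequality \[ \|\langle\boldsymbol\alpha,\mathbf x\rangle\|\leq \frac{\psi(|\mathbf x|)}{|\mathbf x|^2}\bigl(1+B\psi(|\mathbf x|)\bigr) \] has infinitely many solutions $\mathbf x\in\mathbb{Z}^2$.
   Context: $|\mathbf x|$ denotes the Euclidean norm of $\mathbf x\in\mathbb{R}^2$, $\langle\cdot,\cdot\rangle$ the standard inner product, and $\|t\|$ the distance from a real number $t$ to the nearest integer. *)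

theory Defs
  imports "HOL-Analysis.Analysis"
begin

definition dist_nearest_int :: "real \<Rightarrow> real" where
  "dist_nearest_int t = dist t (of_int (round t))"

lemma dist_nearest_int_le: "dist_nearest_int t \<le> dist t (of_int k)"
  using round_diff_minimal[of t k] by (simp add: dist_nearest_int_def dist_real_def)

definition int_lattice2 :: "(real ^ 2) set" where
  "int_lattice2 = {x. \<forall>i. x $ i \<in> \<int>}"

end

theory Submission
  imports Defs
begin

text \<open>
  The point \<open>\<alpha>\<close> is built from integer vectors \<open>v\<^sub>n = (y\<^sub>n, x\<^sub>n)\<close> with
  \<open>v\<^sub>n\<^sub>+\<^sub>3 = v\<^sub>n + a v\<^sub>n\<^sub>+\<^sub>1 + b v\<^sub>n\<^sub>+\<^sub>2\<close>, so that any three consecutive ones form a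
  basis of the integer lattice in dimension 3, like convergents of a continued fraction.
  Write \<open>X\<^sub>n = |x\<^sub>n|\<close> and let \<open>d\<^sub>n\<close> be the planar cross product of \<open>x\<^sub>n\<close> and \<open>x\<^sub>n\<^sub>+\<^sub>1\<close>.
  The lines \<open>y\<^sub>n + \<langle>\<alpha>, x\<^sub>n\<rangle> = 0\<close> and their successors meet in points converging to \<open>\<alpha>\<close>, and
  \<open>y\<^sub>n + \<langle>\<alpha>, x\<^sub>n\<rangle> = (1 + O(X\<^sub>n X\<^sub>n\<^sub>+\<^sub>2 / d\<^sub>n\<^sub>+\<^sub>2)) / d\<^sub>n\<^sub>+\<^sub>1\<close>.
  If the \<open>d\<^sub>n\<close> grow fast enough, every lattice vector is either a multiple of some \<open>v\<^sub>n\<close>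
  or gives a much larger value, so the lower bound reduces to \<open>d\<^sub>n\<^sub>+\<^sub>1 \<le> T\<^sub>n (1 + O(\<psi>(X\<^sub>n)))\<close> with
  \<open>T\<^sub>n = X\<^sub>n\<^sup>2 / \<psi>(X\<^sub>n)\<close>, and the upper bound to \<open>d\<^sub>n\<^sub>+\<^sub>1 = T\<^sub>n + O(X\<^sub>n\<^sup>2)\<close> for infinitely many \<open>n\<close>.

  The vectors come in blocks of four. Let \<open>x\<^sub>1, x\<^sub>2\<close> be nearly orthogonal with
  \<open>X\<^sub>2\<close> comparable to \<open>X\<^sub>1\<close>. If \<open>\<psi>\<close> drops steeply, \<open>\<psi>(X\<^sub>2) \<le> \<psi>(X\<^sub>1)\<^sup>2\<close>, one can afford
  \<open>d\<^sub>2 = T\<^sub>1 + O(d\<^sub>1)\<close> at once. Otherwise take \<open>r = \<psi>(X\<^sub>2)\<^sup>-\<^sup>1\<^sup>/\<^sup>3\<close> and let the lengths grow by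
  factors of order \<open>r\<close>; the coefficient of \<open>v\<^sub>4\<close> alone only allows \<open>d\<^sub>3\<close> to be prescribed up to \<open>d\<^sub>2\<close>,
  but adding a multiple of \<open>v\<^sub>2\<close> to \<open>v\<^sub>3\<close> moves \<open>d\<^sub>3\<close> in steps of \<open>d\<^sub>1\<close> and leaves \<open>d\<^sub>2\<close> fixed.

  Each block leaves a free binary choice, which lets \<open>\<alpha>\<close> avoid any given sequence of points.
\<close>

section \<open>Integer affine forms: height, cross product and determinant\<close>

type_synonym ivec = "int \<times> int \<times> int"

text \<open>A triple \<open>(y, p, q)\<close> stands for the affine form \<open>y + \<langle>\<alpha>, (p, q)\<rangle>\<close>; \<open>hgt\<close>, \<open>crs\<close> and \<open>dot\<close>
  only see its linear part \<open>(p, q)\<close>.\<close>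

fun lin :: "real \<Rightarrow> real \<Rightarrow> ivec \<Rightarrow> real" where
  "lin a b (y, p, q) = y + a * p + b * q"

fun hgt :: "ivec \<Rightarrow> real" where
  "hgt (y, p, q) = sqrt ((real_of_int p)\<^sup>2 + (real_of_int q)\<^sup>2)"

fun crs :: "ivec \<Rightarrow> ivec \<Rightarrow> real" where
  "crs (y, p, q) (y', p', q') = real_of_int (p * q' - q * p')"

fun dot :: "ivec \<Rightarrow> ivec \<Rightarrow> real" where
  "dot (y, p, q) (y', p', q') = real_of_int (p * p' + q * q')"

fun det3 :: "ivec \<Rightarrow> ivec \<Rightarrow> ivec \<Rightarrow> int" where
  "det3 (y, p, q) (y', p', q') (y'', p'', q'') =
     y * (p' * q'' - q' * p'') - p * (y' * q'' - q' * y'') + q * (y' * p'' - p' * y'')"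

fun shift :: "int \<Rightarrow> ivec \<Rightarrow> ivec \<Rightarrow> ivec" where
  "shift k (y, p, q) (y', p', q') = (y' + k * y, p' + k * p, q' + k * q)"

lemma hgt_nonneg [simp]: "0 \<le> hgt u"
  by (cases u) auto

lemma crs_dot_sq: "(crs u v)\<^sup>2 + (dot u v)\<^sup>2 = (hgt u * hgt v)\<^sup>2"
  by (cases u; cases v) (simp add: power_mult_distrib power2_eq_square algebra_simps)

lemma abs_crs_le: "\<bar>crs u v\<bar> \<le> hgt u * hgt v"
proof (rule power2_le_imp_le)
  show "\<bar>crs u v\<bar>\<^sup>2 \<le> (hgt u * hgt v)\<^sup>2"
    using crs_dot_sq[of u v] zero_le_power2[of "dot u v"] unfolding power2_abs by linarith
qed simp

lemma crs_le: "crs u v \<le> hgt u * hgt v"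
  using abs_crs_le[of u v] by linarith

text \<open>\<open>crs\<close> and \<open>dot\<close> are the product of the heights times the sine
  and cosine of the angle, whose absolute values add up to at least 1. This turns control of both
  into a bound on a height.\<close>

lemma hgt_mult_le: "hgt u * hgt v \<le> \<bar>crs u v\<bar> + \<bar>dot u v\<bar>"
proof (rule power2_le_imp_le)
  show "(hgt u * hgt v)\<^sup>2 \<le> (\<bar>crs u v\<bar> + \<bar>dot u v\<bar>)\<^sup>2"
    unfolding crs_dot_sq[symmetric] by (simp add: power2_sum)
qed simp

lemma crs_antisym: "crs v u = - crs u v"
  by (cases u; cases v) auto

lemma shift_simps [simp]:
  "crs u (shift k w v) = crs u v + k * crs u w"
  "crs (shift k w v) u = crs v u + k * crs w u"
  "dot u (shift k w v) = dot u v + k * dot u w"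
  "lin a b (shift k w v) = lin a b v + k * lin a b w"
  by (cases u; cases v; cases w; simp add: algebra_simps)+

lemma crs_self [simp]: "crs u u = 0"
  by (cases u) auto

lemma dot_self: "dot u u = (hgt u)\<^sup>2"
  by (cases u) (simp add: power2_eq_square)

lemma det3_rotate: "det3 v w u = det3 u v w"
  by (cases u; cases v; cases w) (simp add: algebra_simps)

lemma det3_shift [simp]:
  "det3 u v (shift k u w) = det3 u v w"
  "det3 u v (shift k v w) = det3 u v w"
  by (cases u; cases v; cases w; simp add: algebra_simps)+

section \<open>Completing unimodular triples with prescribed cross products\<close>

lemma hgt_shift_le:
  assumes "0 < hgt w"
  shows "hgt w * hgt (shift k w v) \<le> \<bar>crs w v\<bar> + \<bar>dot w v + k * (hgt w)\<^sup>2\<bar>"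
  using hgt_mult_le[of w "shift k w v"] by (simp add: dot_self)

text \<open>Two consecutive multipliers are admissible, and their values at \<open>(a, b)\<close> differ by \<open>lin a b w\<close>;
  hence one of them is not small.\<close>

lemma exists_short_shift:
  assumes "0 < hgt w"
  obtains k where "hgt w * hgt (shift k w z) \<le> \<bar>crs w z\<bar> + 2 * (hgt w)\<^sup>2"
    and "\<bar>lin a b w\<bar> / 2 \<le> \<bar>lin a b (shift k w z)\<bar>"
proof -
  define h where "h = (hgt w)\<^sup>2"
  have h: "h > 0" using assms by (simp add: h_def)
  \<comment> \<open>The remainder \<open>dot w z + k * h\<close> lies in [0, h), and for the
    multiplier \<open>k + 1\<close> in [h, 2h); hence the summand
    \<open>2 * (hgt w)\<^sup>2\<close>.\<close>
  define k where "k = - \<lfloor>dot w z / h\<rfloor>"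
  have "dot w z / h + k \<ge> 0" "dot w z / h + k < 1" unfolding k_def by linarith+
  hence "(dot w z / h + k) * h \<ge> 0" "(dot w z / h + k) * h < 1 * h"
    using h by (simp, intro mult_strict_right_mono, auto)
  hence r: "dot w z + k * h \<ge> 0" "dot w z + k * h < h" using h by (simp_all add: algebra_simps)
  have b: "hgt w * hgt (shift j w z) \<le> \<bar>crs w z\<bar> + 2 * (hgt w)\<^sup>2" if "j = k \<or> j = k + 1" for j
    using hgt_shift_le[OF assms, of j z] r that unfolding h_def[symmetric] by (auto simp: algebra_simps)
  have "lin a b (shift (k + 1) w z) = lin a b (shift k w z) + lin a b w" by (simp add: algebra_simps)
  hence "\<bar>lin a b w\<bar> / 2 \<le> \<bar>lin a b (shift k w z)\<bar> \<or> \<bar>lin a b w\<bar> / 2 \<le> \<bar>lin a b (shift (k + 1) w z)\<bar>"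
    by linarith
  thus thesis using that b by blast
qed

lemma exists_multiple_between:
  fixes x D d :: real
  assumes "0 < d"
  obtains k :: int where "D \<le> x + k * d" "x + k * d < D + d"
proof -
  define k where "k = \<lceil>(D - x) / d\<rceil>"
  have "(D - x) / d \<le> k" "k < (D - x) / d + 1" unfolding k_def by linarith+
  hence "D - x \<le> k * d" "k * d < D - x + d" using assms by (simp_all add: field_simps)
  thus thesis using that[of k] by simp
qed

text \<open>Adding multiples of \<open>v\<close> to \<open>u\<close> keeps the determinant and moves
  the cross product with \<open>w\<close> in steps of \<open>crs v w\<close>, into the window above
  \<open>D\<close>. Multiples of \<open>w\<close> change neither and remain free for making
  \<open>z\<close> short.\<close>

lemma exists_next:
  assumes "det3 u v w = 1" "0 < crs v w" "0 < hgt w" "0 \<le> D"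
  obtains z where "det3 v w z = 1" "D \<le> crs w z" "crs w z < D + crs v w"
    "hgt w * hgt z \<le> crs w z + 2 * (hgt w)\<^sup>2" "\<bar>lin a b w\<bar> / 2 \<le> \<bar>lin a b z\<bar>"
proof -
  obtain k :: int where k: "D \<le> crs w u + k * crs v w" "crs w u + k * crs v w < D + crs v w"
    using exists_multiple_between[OF assms(2)] by blast
  define y where "y = shift (- k) v u"
  have c: "crs w y = crs w u + k * crs v w"
    unfolding y_def by (simp add: crs_antisym[of w v])
  obtain j where j: "hgt w * hgt (shift j w y) \<le> \<bar>crs w y\<bar> + 2 * (hgt w)\<^sup>2"
    "\<bar>lin a b w\<bar> / 2 \<le> \<bar>lin a b (shift j w y)\<bar>"
    using exists_short_shift[OF assms(3)] by metis
  have "det3 v w (shift j w y) = 1"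
    using assms(1) by (simp add: y_def det3_rotate)
  thus thesis using that[of "shift j w y"] k j c assms(4) by simp
qed

text \<open>Here \<open>crs y z\<close> is prescribed up to \<open>crs v w\<close> instead of
  \<open>crs w y\<close>: adding a multiple of \<open>w\<close> to \<open>y\<close> leaves
  \<open>crs w y\<close> alone but shifts \<open>crs y z\<close> in steps of \<open>crs v w\<close>.
  The price is a longer \<open>y\<close>, seen in the last summand of its height bound.\<close>

lemma exists_next2:
  assumes "det3 u v w = 1" "0 < crs v w" "0 < hgt w" "0 < D" "0 \<le> T"
  obtains y z where "det3 v w y = 1" "det3 w y z = 1"
    "D \<le> crs w y" "crs w y < D + crs v w" "T \<le> crs y z" "crs y z < T + crs v w"
    "hgt w * hgt y \<le> crs w y + 2 * (hgt w)\<^sup>2 + crs w y / crs v w * (hgt w)\<^sup>2"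
    "hgt y * hgt z \<le> crs y z + 2 * (hgt y)\<^sup>2"
proof -
  obtain y0 where y0: "det3 v w y0 = 1" "D \<le> crs w y0" "crs w y0 < D + crs v w"
    "hgt w * hgt y0 \<le> crs w y0 + 2 * (hgt w)\<^sup>2"
    using exists_next[OF assms(1-3), of D] assms(4) by (metis less_imp_le)
  define F where "F = crs w y0"
  have F: "F > 0" using y0 assms F_def by linarith
  obtain m :: int where m: "0 \<le> crs y0 v - T + m * F" "crs y0 v - T + m * F < F"
    using exists_multiple_between[OF F, of 0 "crs y0 v - T"] by auto
  \<comment> \<open>\<open>m\<close> alone leaves the excess \<open>r\<close>, possibly almost
    \<open>F\<close>; \<open>k\<close> removes all of it but a remainder below
    \<open>crs v w\<close>.\<close>
  define r where "r = crs y0 v - T + m * F"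
  define k where "k = \<lfloor>r / crs v w\<rfloor>"
  have k0: "k \<ge> 0" unfolding k_def using m assms(2) by (simp add: r_def)
  have kr: "k \<le> r / crs v w" "r / crs v w < k + 1" unfolding k_def by linarith+
  have kF: "k \<le> F / crs v w"
    using kr(1) m(2) assms(2) unfolding r_def[symmetric]
    by (meson divide_strict_right_mono less_imp_le order_trans)
  have kr': "k * crs v w \<le> r" "r < k * crs v w + crs v w"
    using kr assms(2) by (simp_all add: field_simps)
  define y where "y = shift k w y0"
  have cy: "crs w y = F" by (simp add: y_def F_def)
  have hy: "hgt w * hgt y \<le> F + 2 * (hgt w)\<^sup>2 + F / crs v w * (hgt w)\<^sup>2"
  proof -
    have tri: "hgt y \<le> hgt y0 + k * hgt w"
    proof -
      obtain a p q where W: "w = (a, p, q)" by (cases w)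
      obtain a' p' q' where Y: "y0 = (a', p', q')" by (cases y0)
      show ?thesis
        using real_sqrt_sum_squares_triangle_ineq[of "real_of_int p'" "k * real_of_int p" "real_of_int q'" "k * real_of_int q"] k0
        by (simp add: y_def W Y power_mult_distrib real_sqrt_mult flip: distrib_left)
    qed
    have "hgt w * hgt y \<le> hgt w * (hgt y0 + k * hgt w)"
      using tri by (intro mult_left_mono) auto
    also have "\<dots> = hgt w * hgt y0 + k * (hgt w)\<^sup>2" by (simp add: algebra_simps power2_eq_square)
    also have "\<dots> \<le> hgt w * hgt y0 + F / crs v w * (hgt w)\<^sup>2"
      using kF by (intro add_left_mono mult_right_mono) auto
    finally show ?thesis using y0(4) F_def by linarith
  qed
  have ypos: "0 < hgt y"
    using crs_le[of w y] F cy hgt_nonneg[of y] assms(3) by (smt (verit) mult_eq_0_iff)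
  define x where "x = shift (- m) w v"
  have cx: "crs y x = T + (r - k * crs v w)"
    unfolding x_def y_def using crs_antisym[of w y0] crs_antisym[of v w]
    by (simp add: r_def F_def crs_antisym[of w y0] crs_antisym[of w v])
  obtain j where j: "hgt y * hgt (shift j y x) \<le> \<bar>crs y x\<bar> + 2 * (hgt y)\<^sup>2"
    using exists_short_shift[OF ypos] by metis
  have d1: "det3 v w y = 1" by (simp add: y_def y0)
  have d2: "det3 w y (shift j y x) = 1" using d1 by (simp add: x_def det3_rotate)
  show thesis
    by (rule that[of y "shift j y x"]) (use d1 d2 j cx cy hy y0 F_def kr' assms in auto)
qed

section \<open>Convergence of the intersection points of consecutive lines\<close>

lemma geometric_steps_converge:
  fixes s g :: "nat \<Rightarrow> real"
  assumes step: "\<And>m. \<bar>s (Suc m) - s m\<bar> \<le> g m" and halve: "\<And>m. g (Suc m) \<le> g m / 2"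
  obtains L where "s \<longlonglongrightarrow> L" "\<And>m. \<bar>L - s m\<bar> \<le> 2 * g m"
proof -
  have g0: "g m \<ge> 0" for m using step[of m] by linarith
  \<comment> \<open>The bound telescopes, since \<open>halve\<close> gives
    \<open>g m \<le> 2 * g m - 2 * g (Suc m)\<close>.\<close>
  have tail: "\<bar>s (m + k) - s m\<bar> \<le> 2 * g m - 2 * g (m + k)" for m k
  proof (induction k)
    case (Suc k)
    have "\<bar>s (m + Suc k) - s m\<bar> \<le> \<bar>s (Suc (m + k)) - s (m + k)\<bar> + \<bar>s (m + k) - s m\<bar>" by simp
    also have "\<dots> \<le> g (m + k) + (2 * g m - 2 * g (m + k))" using step[of "m + k"] Suc by linarith
    finally show ?case using halve[of "m + k"] by simp
  qed simp
  have gpow: "g m \<le> g 0 * (1/2) ^ m" for m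
  proof (induction m)
    case (Suc m)
    thus ?case using halve[of m] by simp
  qed simp
  have glim: "g \<longlonglongrightarrow> 0"
  proof (rule tendsto_sandwich[of "\<lambda>_. 0" _ _ "\<lambda>m. g 0 * (1/2) ^ m"])
    show "(\<lambda>m. g 0 * (1/2) ^ m) \<longlonglongrightarrow> 0"
      using tendsto_mult_right_zero[OF LIMSEQ_power_zero[of "1/2::real"]] by simp
  qed (use g0 gpow in auto)
  have "Cauchy s"
  proof (rule metric_CauchyI)
    fix e :: real assume "e > 0"
    then obtain M where M: "\<And>m. m \<ge> M \<Longrightarrow> \<bar>g m\<bar> < e / 4"
      using LIMSEQ_D[OF glim, of "e / 4"] by auto
    have near: "\<bar>s m - s M\<bar> < e / 2" if "m \<ge> M" for m
      using tail[of M "m - M"] that M[of M] g0[of m] by simp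
    have "dist (s m) (s n) < e" if "m \<ge> M" "n \<ge> M" for m n
      using near[OF that(1)] near[OF that(2)] unfolding dist_real_def by linarith
    thus "\<exists>M. \<forall>m\<ge>M. \<forall>n\<ge>M. dist (s m) (s n) < e" by blast
  qed
  then obtain L where L: "s \<longlonglongrightarrow> L" using Cauchy_convergent convergent_def by blast
  have "\<bar>L - s m\<bar> \<le> 2 * g m" for m
  proof (rule LIMSEQ_le_const2)
    show "(\<lambda>k. \<bar>s (k + m) - s m\<bar>) \<longlonglongrightarrow> \<bar>L - s m\<bar>"
      by (intro tendsto_intros LIMSEQ_ignore_initial_segment L)
    show "\<exists>N. \<forall>k\<ge>N. \<bar>s (k + m) - s m\<bar> \<le> 2 * g m"
      using tail[of m] g0 by (smt (verit) add.commute)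
  qed
  with L show thesis using that by blast
qed

text \<open>Common zero of two affine forms by Cramer's rule, meaningful when \<open>crs\<close> is
  nonzero.\<close>

fun meet :: "ivec \<Rightarrow> ivec \<Rightarrow> real \<times> real" where
  "meet (y, p, q) (y', p', q') =
     (real_of_int (q * y' - y * q') / crs (y, p, q) (y', p', q'),
      real_of_int (y * p' - p * y') / crs (y, p, q) (y', p', q'))"

text \<open>Both sides are linear in \<open>u\<close>, vanish at \<open>v\<close> and
  \<open>w\<close>, and take the value 1 at the constant form \<open>(1, 0, 0)\<close>.\<close>

lemma lin_meet:
  assumes "crs v w \<noteq> 0"
  shows "lin (fst (meet v w)) (snd (meet v w)) u = det3 u v w / crs v w"
proof -
  obtain y p q where u: "u = (y, p, q)" by (cases u)
  obtain y' p' q' where v: "v = (y', p', q')" by (cases v)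
  obtain y'' p'' q'' where w: "w = (y'', p'', q'')" by (cases w)
  have "real_of_int (det3 u v w)
      = y * crs v w + real_of_int (q' * y'' - y' * q'') * p + real_of_int (y' * p'' - p' * y'') * q"
    by (simp add: u v w algebra_simps)
  hence "real_of_int (det3 u v w) / crs v w
      = y + real_of_int (q' * y'' - y' * q'') / crs v w * p + real_of_int (y' * p'' - p' * y'') / crs v w * q"
    using assms by (simp add: add_divide_distrib)
  moreover have "meet v w = (real_of_int (q' * y'' - y' * q'') / crs v w, real_of_int (y' * p'' - p' * y'') / crs v w)"
    unfolding v w meet.simps by (rule refl)
  ultimately show ?thesis by (simp add: u)
qed

text \<open>Both points lie on the line of \<open>v\<close>, so the difference is proportional to
  \<open>crs z v\<close>; a Pluecker-type identity gives the factor.\<close>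

lemma lin_meet_diff:
  assumes "crs u v \<noteq> 0" "crs v w \<noteq> 0" "det3 u v w = 1"
  shows "lin (fst (meet v w)) (snd (meet v w)) z - lin (fst (meet u v)) (snd (meet u v)) z
     = crs z v / (crs u v * crs v w)"
proof -
  have "real_of_int (det3 z v w) * crs u v - real_of_int (det3 z u v) * crs v w = real_of_int (det3 u v w) * crs z v"
    by (cases u; cases v; cases w; cases z) (simp add: algebra_simps)
  thus ?thesis using assms by (simp add: lin_meet field_simps)
qed

locale lattice_chain =
  fixes v :: "nat \<Rightarrow> ivec"
  assumes det: "det3 (v n) (v (Suc n)) (v (Suc (Suc n))) = 1"
    and grow: "8 * (hgt (v n))\<^sup>2 \<le> crs (v n) (v (Suc n))"
    and start: "1 \<le> hgt (v 0)"
begin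

abbreviation X where "X n \<equiv> hgt (v n)"
abbreviation d where "d n \<equiv> crs (v n) (v (Suc n))"

lemma X_step: "8 * X n \<le> X (Suc n)" if "0 < X n"
proof -
  have "X n * (8 * X n) \<le> X n * X (Suc n)"
    using grow[of n] crs_le[of "v n" "v (Suc n)"] by (simp add: power2_eq_square)
  thus ?thesis using that by simp
qed

lemma X_ge1: "1 \<le> X n"
proof (induction n)
  case (Suc n)
  thus ?case using X_step[of n] by linarith
qed (use start in simp)

lemma X_pos [simp]: "0 < X n" using X_ge1[of n] by linarith

lemma X_neq_0 [simp]: "X n \<noteq> 0"
  using X_pos[of n] by (rule less_imp_neq[THEN not_sym])

lemma X_Suc: "8 * X n \<le> X (Suc n)" by (simp add: X_step)

lemma X_ge_index: "real n \<le> X n"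
proof (induction n)
  case (Suc n)
  thus ?case using X_Suc[of n] X_ge1[of n] by simp
qed simp

lemma d_pos [simp]: "0 < d n"
  using grow[of n] zero_less_power[OF X_pos[of n], of 2] by linarith

lemma d_neq_0 [simp]: "d n \<noteq> 0"
  using d_pos[of n] by (rule less_imp_neq[THEN not_sym])

lemma d_nonneg [simp]: "0 \<le> d n"
  using d_pos[of n] by (rule less_imp_le)

lemma d_le: "d n \<le> X n * X (Suc n)" by (rule crs_le)

lemma d_Suc: "64 * d n \<le> d (Suc n)"
proof -
  have "64 * d n \<le> 64 * (X n * X (Suc n))" using d_le by simp
  also have "\<dots> = 8 * (8 * X n) * X (Suc n)" by simp
  also have "\<dots> \<le> 8 * X (Suc n) * X (Suc n)"
    using X_Suc[of n] X_pos[of "Suc n"] by (intro mult_right_mono mult_left_mono) auto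
  also have "\<dots> \<le> d (Suc n)" using grow[of "Suc n"] by (simp add: power2_eq_square)
  finally show ?thesis .
qed

text \<open>Consecutive meeting points share the line of \<open>v (Suc m)\<close>, so by
  \<open>lin_meet_diff\<close> the value of a form \<open>z\<close> moves by at most
  \<open>hgt z * g m\<close>, and \<open>g\<close> halves. For \<open>z = v n\<close> the movement
  is counted from index \<open>Suc n\<close> on, where unimodularity makes the value exactly
  \<open>1 / d (Suc n)\<close>.\<close>

lemma exists_limit_point:
  obtains a b where "\<And>n. \<bar>lin a b (v n) - 1 / d (Suc n)\<bar>
     \<le> 2 * X n * X (Suc (Suc n)) / (d (Suc n) * d (Suc (Suc n)))"
proof -
  define A where "A m = fst (meet (v m) (v (Suc m)))" for m
  define B where "B m = snd (meet (v m) (v (Suc m)))" for m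
  define g where "g m = X (Suc m) / (d m * d (Suc m))" for m
  have halve: "g (Suc m) \<le> g m / 2" for m
  proof -
    have "2 * X (Suc (Suc m)) * d m \<le> 2 * X (Suc (Suc m)) * (X m * X (Suc m))"
      using d_le[of m] by (intro mult_left_mono) auto
    also have "\<dots> = X (Suc m) * X (Suc (Suc m)) * (2 * X m)" by simp
    also have "\<dots> \<le> X (Suc m) * X (Suc (Suc m)) * (8 * X (Suc (Suc m)))"
      using X_Suc[of m] X_Suc[of "Suc m"] X_pos[of m] by (intro mult_left_mono) (linarith, simp)
    also have "\<dots> = X (Suc m) * (8 * (X (Suc (Suc m)))\<^sup>2)" by (simp add: power2_eq_square)
    also have "\<dots> \<le> X (Suc m) * d (Suc (Suc m))" using grow by (intro mult_left_mono) auto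
    finally show ?thesis unfolding g_def by (simp add: field_simps)
  qed
  have dlin: "lin (A (Suc m)) (B (Suc m)) z - lin (A m) (B m) z = crs z (v (Suc m)) / (d m * d (Suc m))" for m z
    unfolding A_def B_def by (intro lin_meet_diff det less_imp_neq[THEN not_sym] d_pos)
  have blin: "\<bar>lin (A (Suc m)) (B (Suc m)) z - lin (A m) (B m) z\<bar> \<le> hgt z * g m" for m z
    unfolding dlin g_def using abs_crs_le[of z "v (Suc m)"] by (simp add: abs_mult abs_of_pos divide_right_mono less_imp_le)
  \<comment> \<open>The forms \<open>(0, 1, 0)\<close> and \<open>(0, 0, 1)\<close> have height 1
    and read off the two coordinates.\<close>
  have "\<bar>A (Suc m) - A m\<bar> \<le> g m" "\<bar>B (Suc m) - B m\<bar> \<le> g m" for m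
    using blin[of m "(0, 1, 0)"] blin[of m "(0, 0, 1)"] by simp_all
  then obtain a b where lim: "A \<longlonglongrightarrow> a" "B \<longlonglongrightarrow> b"
    using geometric_steps_converge[of A g] geometric_steps_converge[of B g] halve by metis
  have "\<bar>lin a b (v n) - 1 / d (Suc n)\<bar> \<le> 2 * X n * X (Suc (Suc n)) / (d (Suc n) * d (Suc (Suc n)))" for n
  proof -
    obtain L where L: "(\<lambda>m. lin (A m) (B m) (v n)) \<longlonglongrightarrow> L"
      "\<And>m. \<bar>L - lin (A m) (B m) (v n)\<bar> \<le> 2 * (X n * g m)"
      using geometric_steps_converge[of "\<lambda>m. lin (A m) (B m) (v n)" "\<lambda>m. X n * g m"] blin halve
      by (metis (no_types, lifting) X_pos less_imp_le mult_left_mono times_divide_eq_right)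
    have "(\<lambda>m. lin (A m) (B m) (v n)) \<longlonglongrightarrow> lin a b (v n)"
      by (cases "v n") (auto intro!: tendsto_intros lim)
    hence "L = lin a b (v n)" using L(1) LIMSEQ_unique by blast
    moreover have "lin (A (Suc n)) (B (Suc n)) (v n) = 1 / d (Suc n)"
      unfolding A_def B_def using d_pos[of "Suc n"] det[of n] by (subst lin_meet) auto
    ultimately show ?thesis using L(2)[of "Suc n"] by (simp add: g_def mult.assoc)
  qed
  thus thesis using that by blast
qed

end

section \<open>Values of the chain at the limit point and the lower bound for all lattice
  vectors\<close>

lemma det3_lin:
  "real_of_int (det3 u w z) = lin a b u * crs w z + lin a b w * crs z u + lin a b z * crs u w"
  by (cases u; cases w; cases z) (simp add: algebra_simps)

text \<open>Cramer's rule; determinant 1 makes the coefficients integers.\<close>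

lemma unimodular_expansion:
  assumes "det3 u w z = 1"
  shows "m = shift (det3 m w z) u (shift (det3 u m z) w (shift (det3 u w m) z (0, 0, 0)))"
proof -
  obtain y p q where u: "u = (y, p, q)" by (cases u)
  obtain y' p' q' where w: "w = (y', p', q')" by (cases w)
  obtain y'' p'' q'' where z: "z = (y'', p'', q'')" by (cases z)
  obtain r s t where m: "m = (r, s, t)" by (cases m)
  have "r * det3 u w z = det3 u w m * y'' + det3 u m z * y' + det3 m w z * y"
    "s * det3 u w z = det3 u w m * p'' + det3 u m z * p' + det3 m w z * p"
    "t * det3 u w z = det3 u w m * q'' + det3 u m z * q' + det3 m w z * q"
    unfolding u w z m by (simp_all add: algebra_simps)
  thus ?thesis using assms unfolding m u w z by simp
qed

lemma scaled_zero_simps: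
  "lin a b (shift k w (0, 0, 0)) = k * lin a b w"
  "crs u (shift k w (0, 0, 0)) = k * crs u w"
  "crs u (0, 0, 0) = 0"
  "lin a b (0, 0, 0) = 0"
  by (cases u; cases w; simp add: algebra_simps)+

lemma hgt_scaled: "hgt (shift k w (0, 0, 0)) = \<bar>real_of_int k\<bar> * hgt w"
  by (cases w) (simp add: power_mult_distrib real_sqrt_mult flip: distrib_left)

lemma shift_0 [simp]: "shift 0 w u = u"
  by (cases u; cases w) simp

text \<open>The last condition makes the relative error of \<open>lin a b u * crs v w = 1\<close> at the limit point
  of order \<open>\<psi> (hgt u)\<close>.\<close>

definition hit :: "(real \<Rightarrow> real) \<Rightarrow> ivec \<Rightarrow> ivec \<Rightarrow> ivec \<Rightarrow> ivec \<Rightarrow> bool" where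
  "hit \<psi> u v w z \<longleftrightarrow>
     (hgt u)\<^sup>2 / \<psi> (hgt u) \<le> crs v w \<and>
     crs v w \<le> (hgt u)\<^sup>2 / \<psi> (hgt u) + 16 * (hgt u)\<^sup>2 \<and>
     hgt u * hgt w / (32 * \<psi> (hgt u)) \<le> crs w z"

text \<open>\<open>spread\<close> prevents cancellation between the values of two consecutive
  vectors. \<open>size\<close> leaves almost a factor 4 of room in the lower bound except at a
  \<open>hit\<close>. \<open>size_0\<close> covers the start, where no preceding vector is
  available.\<close>

locale spread_chain = lattice_chain v for v +
  fixes \<psi> :: "real \<Rightarrow> real" and a b :: real
  assumes psi_pos: "\<And>x. 1 \<le> x \<Longrightarrow> 0 < \<psi> x"
    and psi_antimono: "\<And>x y. 1 \<le> x \<Longrightarrow> x \<le> y \<Longrightarrow> \<psi> y \<le> \<psi> x"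
    and psi_small: "\<psi> 1 \<le> 1 / 1000"
    and spread: "\<And>n. 4 * (d (Suc n))\<^sup>2 * X n \<le> X (Suc n) * d n * d (Suc (Suc n))"
    and size: "\<And>n. d (Suc n) \<le> (X n)\<^sup>2 / (4 * \<psi> (X n))
        \<or> hit \<psi> (v n) (v (Suc n)) (v (Suc (Suc n))) (v (Suc (Suc (Suc n))))"
    and X_0: "X 0 = 1"
    and size_0: "d 1 \<le> 1 / (4 * \<psi> 1)"
    and limit_point: "\<And>n. \<bar>lin a b (v n) - 1 / d (Suc n)\<bar>
        \<le> 2 * X n * X (Suc (Suc n)) / (d (Suc n) * d (Suc (Suc n)))"
begin

abbreviation e where "e n \<equiv> lin a b (v n)"
abbreviation q where "q n \<equiv> \<psi> (X n)"

lemma q_pos [simp]: "0 < q n" by (simp add: psi_pos X_ge1)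

lemma q_neq_0 [simp]: "q n \<noteq> 0"
  using q_pos[of n] by (rule less_imp_neq[THEN not_sym])

lemma q_nonneg [simp]: "0 \<le> q n"
  using q_pos[of n] by (rule less_imp_le)

lemma psi_le: "1 \<le> x \<Longrightarrow> \<psi> x \<le> 1 / 1000"
  using psi_antimono[of 1 x] psi_small by simp

lemma rel_error: "\<bar>e n * d (Suc n) - 1\<bar> \<le> 2 * X n * X (Suc (Suc n)) / d (Suc (Suc n))"
proof -
  have "\<bar>e n * d (Suc n) - 1\<bar> = \<bar>e n - 1 / d (Suc n)\<bar> * d (Suc n)"
  proof -
    have "e n * d (Suc n) - 1 = (e n - 1 / d (Suc n)) * d (Suc n)" by (simp add: left_diff_distrib)
    thus ?thesis by (simp add: abs_mult abs_of_pos)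
  qed
  also have "\<dots> \<le> 2 * X n * X (Suc (Suc n)) / (d (Suc n) * d (Suc (Suc n))) * d (Suc n)"
    using limit_point[of n] by (intro mult_right_mono) auto
  finally show ?thesis using d_pos[of "Suc n"] by simp
qed

text \<open>Heights grow by 64 over two steps, so \<open>rel_error\<close> is at most 1/256.\<close>

lemma e_bounds: "99 / 100 \<le> e n * d (Suc n)" "e n * d (Suc n) \<le> 101 / 100"
proof -
  have "X n * 64 \<le> X (Suc (Suc n))" using X_Suc[of n] X_Suc[of "Suc n"] by linarith
  hence "X n * 64 * X (Suc (Suc n)) \<le> (X (Suc (Suc n)))\<^sup>2"
    by (simp add: power2_eq_square)
  hence "2 * X n * X (Suc (Suc n)) \<le> 1 / 100 * d (Suc (Suc n))"
    using grow[of "Suc (Suc n)"] d_pos[of "Suc (Suc n)"] by linarith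
  hence "2 * X n * X (Suc (Suc n)) / d (Suc (Suc n)) \<le> 1 / 100"
    by (simp add: pos_divide_le_eq)
  thus "99 / 100 \<le> e n * d (Suc n)" "e n * d (Suc n) \<le> 101 / 100"
    using rel_error[of n] by linarith+
qed

lemma e_pos [simp]: "0 < e n"
proof -
  have "0 < e n * d (Suc n)" using e_bounds[of n] by linarith
  thus ?thesis using d_pos[of "Suc n"] by (simp add: zero_less_mult_iff)
qed

lemma e_nonneg [simp]: "0 \<le> e n"
  using e_pos[of n] by (rule less_imp_le)

lemma e_ge: "99 / 100 / d (Suc n) \<le> e n" and e_le: "e n \<le> 101 / 100 / d (Suc n)"
  using e_bounds[of n] by (simp_all add: pos_divide_le_eq pos_le_divide_eq)

text \<open>The strict inequality is what separates the limit point from points where the reverse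
  one has been arranged.\<close>

lemma e_Suc: "e (Suc n) < e n / 2"
proof -
  have "e (Suc n) \<le> 101 / 100 / d (Suc (Suc n))" by (rule e_le)
  also have "\<dots> \<le> 101 / 100 / (64 * d (Suc n))"
    using d_Suc[of "Suc n"] by (intro divide_left_mono) auto
  also have "\<dots> < 99 / 100 / d (Suc n) / 2" by (simp add: field_simps)
  also have "\<dots> \<le> e n / 2" using e_ge[of n] by simp
  finally show ?thesis .
qed

lemma hit_error:
  assumes "hit \<psi> (v n) (v (Suc n)) (v (Suc (Suc n))) (v (Suc (Suc (Suc n))))"
  shows "\<bar>e n * d (Suc n) - 1\<bar> \<le> 64 * q n"
proof -
  have "2 * X n * X (Suc (Suc n)) \<le> 64 * q n * d (Suc (Suc n))"
    using assms by (simp add: hit_def field_simps)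
  hence "2 * X n * X (Suc (Suc n)) / d (Suc (Suc n)) \<le> 64 * q n"
    by (simp add: pos_divide_le_eq)
  thus ?thesis using rel_error[of n] by linarith
qed

lemma hit_upper:
  assumes "hit \<psi> (v n) (v (Suc n)) (v (Suc (Suc n))) (v (Suc (Suc (Suc n))))"
  shows "e n \<le> q n / (X n)\<^sup>2 * (1 + 80 * q n)"
proof -
  have "e n * ((X n)\<^sup>2 / q n) \<le> e n * d (Suc n)"
    using assms by (intro mult_left_mono) (auto simp: hit_def)
  also have "\<dots> \<le> 1 + 80 * q n" using hit_error[OF assms] q_pos[of n] by linarith
  finally have "e n * ((X n)\<^sup>2 / q n) \<le> 1 + 80 * q n" .
  hence "e n * (X n)\<^sup>2 \<le> q n * (1 + 80 * q n)" by (simp add: field_simps)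
  thus ?thesis by (simp add: pos_le_divide_eq)
qed

lemma e_lower: "q n / (X n)\<^sup>2 * (1 - 80 * q n) \<le> e n"
  using size[of n]
proof
  assume "d (Suc n) \<le> (X n)\<^sup>2 / (4 * q n)"
  hence "99 / 100 \<le> e n * ((X n)\<^sup>2 / (4 * q n))"
    using e_bounds(1)[of n] mult_left_mono[of _ _ "e n"] by (meson e_pos less_imp_le order_trans)
  hence "99 / 100 * (4 * q n) \<le> e n * (X n)\<^sup>2"
    by (simp add: pos_le_divide_eq)
  hence "q n \<le> e n * (X n)\<^sup>2" using q_pos[of n] by linarith
  hence "q n * (1 - 80 * q n) \<le> e n * (X n)\<^sup>2"
    using mult_pos_pos[OF q_pos[of n] q_pos[of n]] unfolding right_diff_distrib mult.left_commute[of "q n" 80] by linarith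
  thus ?thesis by (simp add: pos_divide_le_eq)
next
  assume h: "hit \<psi> (v n) (v (Suc n)) (v (Suc (Suc n))) (v (Suc (Suc (Suc n))))"
  \<comment> \<open>The 80 is 64 from \<open>hit_error\<close> plus 16 from the excess that
    \<open>hit\<close> tolerates.\<close>
  have "(1 - 80 * q n) * (1 + 16 * q n) = 1 - 64 * q n - 1280 * (q n * q n)" by (simp add: algebra_simps)
  also have "\<dots> \<le> e n * d (Suc n)"
    using hit_error[OF h] mult_pos_pos[OF q_pos[of n] q_pos[of n]] by linarith
  also have "\<dots> \<le> e n * ((X n)\<^sup>2 / q n + 16 * (X n)\<^sup>2)"
    using h by (intro mult_left_mono) (auto simp: hit_def)
  also have "\<dots> = (e n * ((X n)\<^sup>2 / q n)) * (1 + 16 * q n)"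
    using q_pos[of n] by (simp add: field_simps)
  finally have "1 - 80 * q n \<le> e n * ((X n)\<^sup>2 / q n)"
    by (rule mult_right_le_imp_le) (use q_pos[of n] in linarith)
  hence "q n * (1 - 80 * q n) \<le> e n * (X n)\<^sup>2" by (simp add: field_simps)
  thus ?thesis by (simp add: pos_divide_le_eq)
qed

text \<open>The function t - 80 t^2 increases for t up to 1/160, and \<psi> stays below
  1/1000.\<close>

lemma psi_term_antimono:
  assumes "1 \<le> x" "x \<le> y"
  shows "\<psi> y / y\<^sup>2 * (1 - 80 * \<psi> y) \<le> \<psi> x / x\<^sup>2 * (1 - 80 * \<psi> x)"
proof -
  have s: "0 < \<psi> y" "\<psi> y \<le> \<psi> x" "\<psi> x \<le> 1 / 1000"
    using assms psi_pos[of y] psi_antimono[of x y] psi_le[of x] by auto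
  have "0 \<le> (\<psi> x - \<psi> y) * (1 - 80 * (\<psi> x + \<psi> y))"
    using s by (intro mult_nonneg_nonneg) auto
  hence "\<psi> y * (1 - 80 * \<psi> y) \<le> \<psi> x * (1 - 80 * \<psi> x)" by (simp add: algebra_simps)
  hence "\<psi> y * (1 - 80 * \<psi> y) / y\<^sup>2 \<le> \<psi> x * (1 - 80 * \<psi> x) / x\<^sup>2"
    using s assms by (intro frac_le mult_nonneg_nonneg power_mono) auto
  thus ?thesis by simp
qed

text \<open>If the value at \<open>m\<close> is small, the integer
  \<open>det3 (v n) (v (Suc n)) m\<close> has absolute value below 1, so \<open>m\<close> is a
  combination of \<open>v n\<close> and \<open>v (Suc n)\<close> with coefficients \<open>A\<close>,
  \<open>B\<close>. If \<open>A\<close> is nonzero, \<open>spread\<close> keeps the \<open>B\<close>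
  part below half of \<open>e n\<close>, which the \<open>A\<close> part then outweighs.\<close>

lemma multiple_or_far:
  assumes "2 * hgt m * X (Suc n) \<le> d (Suc n)"
  shows "(\<exists>k. m = shift k (v (Suc n)) (0, 0, 0)) \<or> e n / 2 \<le> \<bar>lin a b m\<bar>"
proof (rule disjCI)
  assume far: "\<not> e n / 2 \<le> \<bar>lin a b m\<bar>"
  define N where "N = hgt m"
  have N0: "0 \<le> N" by (simp add: N_def)
  have NX: "2 * N * X (Suc n) \<le> d (Suc n)" using assms N_def by simp
  let ?C = "det3 (v n) (v (Suc n)) m"
  have "real_of_int ?C = e n * crs (v (Suc n)) m + e (Suc n) * crs m (v n) + lin a b m * d n"
    by (rule det3_lin)
  moreover have "\<bar>e n * crs (v (Suc n)) m\<bar> \<le> 101 / 200"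
  proof -
    have "\<bar>e n * crs (v (Suc n)) m\<bar> \<le> e n * (X (Suc n) * N)"
      using abs_crs_le[of "v (Suc n)" m] by (simp add: abs_mult abs_of_pos N_def)
    also have "\<dots> \<le> e n * (d (Suc n) / 2)" using NX by (intro mult_left_mono) (simp_all add: mult_ac)
    finally show ?thesis using e_bounds(2)[of n] by simp
  qed
  moreover have "\<bar>e (Suc n) * crs m (v n)\<bar> \<le> 1 / 8"
  proof -
    have "\<bar>e (Suc n) * crs m (v n)\<bar> \<le> e (Suc n) * (N * X n)"
      using abs_crs_le[of m "v n"] by (simp add: abs_mult abs_of_pos N_def)
    also have "\<dots> \<le> e (Suc n) * (d (Suc n) / 2)"
    proof (intro mult_left_mono)
      have "N * X n \<le> N * X (Suc n)" using X_Suc[of n] X_pos[of n] N0 by (intro mult_left_mono) (linarith, simp)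
      thus "N * X n \<le> d (Suc n) / 2" using NX by simp
    qed (simp add: less_imp_le)
    also have "\<dots> \<le> e (Suc n) * (d (Suc (Suc n)) / 128)"
      using d_Suc[of "Suc n"] by (intro mult_left_mono) auto
    finally show ?thesis using e_bounds(2)[of "Suc n"] by simp
  qed
  moreover have "\<bar>lin a b m * d n\<bar> \<le> 1 / 8"
  proof -
    have "\<bar>lin a b m * d n\<bar> \<le> e n / 2 * d n"
      using far by (simp add: abs_mult abs_of_pos)
    also have "\<dots> \<le> e n / 2 * (d (Suc n) / 64)"
      using d_Suc[of n] by (intro mult_left_mono) auto
    finally show ?thesis using e_bounds(2)[of n] by simp
  qed
  ultimately have "\<bar>real_of_int ?C\<bar> < 1" by linarith
  hence C: "?C = 0" by linarith
  define A where "A = det3 m (v (Suc n)) (v (Suc (Suc n)))"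
  define B where "B = det3 (v n) m (v (Suc (Suc n)))"
  have m: "m = shift A (v n) (shift B (v (Suc n)) (0, 0, 0))"
    using unimodular_expansion[OF det[of n], of m] C by (simp add: A_def B_def)
  have "A = 0"
  proof (rule ccontr)
    assume "A \<noteq> 0"
    hence A1: "1 \<le> \<bar>real_of_int A\<bar>" by linarith
    \<comment> \<open>Pairing with \<open>v n\<close> removes the \<open>A\<close> part and isolates
      \<open>B\<close>.\<close>
    have "crs (v n) m = B * d n" by (subst m) (simp add: scaled_zero_simps)
    hence "\<bar>real_of_int B\<bar> * d n \<le> X n * N"
      using abs_crs_le[of "v n" m] by (simp add: abs_mult abs_of_pos N_def)
    hence "(\<bar>real_of_int B\<bar> * d n) * (2 * X (Suc n)) \<le> X n * N * (2 * X (Suc n))"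
      by (intro mult_right_mono) auto
    also have "\<dots> \<le> X n * d (Suc n)" using NX X_pos[of n] by simp
    finally have BX: "\<bar>real_of_int B\<bar> * d n * (2 * X (Suc n)) \<le> X n * d (Suc n)" .
    have "8 * \<bar>real_of_int B\<bar> * d (Suc n) * (d n * X (Suc n))
        = (\<bar>real_of_int B\<bar> * d n * (2 * X (Suc n))) * (4 * d (Suc n))" by simp
    also have "\<dots> \<le> X n * d (Suc n) * (4 * d (Suc n))"
      using BX by (intro mult_right_mono) auto
    also have "\<dots> = 4 * (d (Suc n))\<^sup>2 * X n" by (simp add: power2_eq_square)
    also have "\<dots> \<le> d (Suc (Suc n)) * (d n * X (Suc n))" using spread[of n] by (simp add: mult_ac)
    finally have Bd: "8 * \<bar>real_of_int B\<bar> * d (Suc n) \<le> d (Suc (Suc n))"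
      using mult_pos_pos[OF d_pos[of n] X_pos[of "Suc n"]] by simp
    have "\<bar>real_of_int B\<bar> * e (Suc n) * (8 * d (Suc n)) = e (Suc n) * (8 * \<bar>real_of_int B\<bar> * d (Suc n))" by simp
    also have "\<dots> \<le> e (Suc n) * d (Suc (Suc n))" using Bd by (intro mult_left_mono) auto
    also have "\<dots> \<le> 101 / 100" by (rule e_bounds)
    also have "\<dots> \<le> e n / 2 * (8 * d (Suc n))" using e_bounds(1)[of n] by simp
    finally have Be: "\<bar>real_of_int B\<bar> * e (Suc n) \<le> e n / 2" using d_pos[of "Suc n"] by simp
    have "lin a b m = B * e (Suc n) + A * e n" by (subst m) (simp add: scaled_zero_simps)
    hence "\<bar>lin a b m\<bar> \<ge> \<bar>real_of_int A\<bar> * e n - \<bar>real_of_int B\<bar> * e (Suc n)"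
      using e_pos[of n] e_pos[of "Suc n"] 
        abs_mult[of "real_of_int A" "e n"] abs_mult[of "real_of_int B" "e (Suc n)"] by linarith
    moreover have "e n \<le> \<bar>real_of_int A\<bar> * e n" using A1 e_pos[of n] by simp
    ultimately show False using far Be by linarith
  qed
  thus "\<exists>k. m = shift k (v (Suc n)) (0, 0, 0)" using m by auto
qed

text \<open>Apply \<open>multiple_or_far\<close> at the least admissible index. Multiples reduce to
  \<open>e_lower\<close> by monotonicity; otherwise minimality makes \<open>hgt m\<close> large
  against \<open>X n\<close>, so the required bound falls below \<open>e n / 2\<close>.\<close>

lemma lower_bound:
  assumes "1 \<le> hgt m"
  shows "\<psi> (hgt m) / (hgt m)\<^sup>2 * (1 - 80 * \<psi> (hgt m)) \<le> \<bar>lin a b m\<bar>"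
proof -
  define N where "N = hgt m"
  have N1: "1 \<le> N" using assms N_def by simp
  have q: "0 < \<psi> N" "\<psi> N \<le> \<psi> 1" using psi_pos psi_antimono[of 1 N] N1 by auto
  define n where "n = (LEAST n. 2 * N * X (Suc n) \<le> d (Suc n))"
  have "\<exists>n. 2 * N * X (Suc n) \<le> d (Suc n)"
  proof -
    obtain n :: nat where "N \<le> n" using real_arch_simple by blast
    hence "N \<le> X (Suc n)" using X_ge_index[of "Suc n"] by simp
    hence "N * X (Suc n) \<le> X (Suc n) * X (Suc n)" by (intro mult_right_mono) auto
    hence "2 * N * X (Suc n) \<le> 8 * (X (Suc n))\<^sup>2"
      using zero_le_power2[of "X (Suc n)"] unfolding power2_eq_square by linarith
    thus ?thesis using grow[of "Suc n"] by (metis order_trans)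
  qed
  hence n: "2 * N * X (Suc n) \<le> d (Suc n)" unfolding n_def by (rule LeastI_ex)
  show ?thesis
    using multiple_or_far[OF n[unfolded N_def]]
  proof
    assume "\<exists>k. m = shift k (v (Suc n)) (0, 0, 0)"
    then obtain k where k: "m = shift k (v (Suc n)) (0, 0, 0)" by blast
    have Nk: "N = \<bar>real_of_int k\<bar> * X (Suc n)" by (simp add: N_def k hgt_scaled)
    hence "k \<noteq> 0" using N1 by auto
    hence k1: "1 \<le> \<bar>real_of_int k\<bar>" by linarith
    have "\<psi> N / N\<^sup>2 * (1 - 80 * \<psi> N) \<le> q (Suc n) / (X (Suc n))\<^sup>2 * (1 - 80 * q (Suc n))"
      using k1 X_pos[of "Suc n"] X_ge1 Nk by (intro psi_term_antimono) auto
    also have "\<dots> \<le> e (Suc n)" by (rule e_lower)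
    also have "\<dots> \<le> \<bar>real_of_int k\<bar> * e (Suc n)" using k1 e_pos[of "Suc n"] by simp
    also have "\<dots> = \<bar>lin a b m\<bar>" by (simp add: k scaled_zero_simps abs_mult abs_of_pos)
    finally show ?thesis unfolding N_def .
  next
    assume far: "e n / 2 \<le> \<bar>lin a b m\<bar>"
    have "\<psi> N / N\<^sup>2 \<le> e n / 2"
    proof (cases n)
      \<comment> \<open>Minimality says nothing here; \<open>size_0\<close> takes its place.\<close>
      case 0
      have "d 1 * (4 * \<psi> 1) \<le> 1" using size_0 psi_pos[of 1] by (simp add: pos_le_divide_eq)
      hence "e 0 * (d 1 * (4 * \<psi> 1)) \<le> e 0 * 1" by (intro mult_left_mono) auto
      hence *: "(e 0 * d 1) * (4 * \<psi> 1) \<le> e 0" by (simp add: mult_ac)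
      have "99 / 100 * (4 * \<psi> 1) \<le> (e 0 * d 1) * (4 * \<psi> 1)"
        using e_bounds(1)[of 0] psi_pos[of 1] by (intro mult_right_mono) auto
      hence "\<psi> 1 \<le> e n / 2" using * psi_pos[of 1] unfolding 0 by linarith
      moreover have "\<psi> N / N\<^sup>2 \<le> \<psi> N / 1" using N1 q by (intro divide_left_mono) auto
      ultimately show ?thesis using q by linarith
    next
      case (Suc l)
      have "\<not> 2 * N * X (Suc l) \<le> d (Suc l)"
        by (rule not_less_Least[of l "\<lambda>n. 2 * N * X (Suc n) \<le> d (Suc n)", folded n_def]) (simp add: Suc)
      hence "8 * (X (Suc l))\<^sup>2 < 2 * N * X (Suc l)" using grow[of "Suc l"] by linarith
      \<comment> \<open>The factor 4 gives 1/16 after squaring, well below the 1/4 left by halving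
        \<open>e n\<close> and bounding \<open>1 - 80 * q n\<close> by 1/2.\<close>
      hence X4: "4 * X n < N" using X_pos[of n] unfolding Suc by (simp add: power2_eq_square)
      have "e n \<ge> q n / (X n)\<^sup>2 * (1 - 80 * q n)" by (rule e_lower)
      moreover have "q n / (X n)\<^sup>2 * (1 - 80 * q n) \<ge> q n / (X n)\<^sup>2 * (1 / 2)"
        using psi_le[OF X_ge1[of n]] by (intro mult_left_mono) auto
      ultimately have en: "q n / (X n)\<^sup>2 / 4 \<le> e n / 2" by simp
      have "\<psi> N / N\<^sup>2 \<le> q n / (4 * X n)\<^sup>2"
        using X4 psi_antimono[of "X n" N] X_ge1[of n] q by (intro frac_le power_mono) auto
      also have "\<dots> \<le> q n / (X n)\<^sup>2 / 4" using q_pos[of n] by (simp add: power_mult_distrib field_simps)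
      finally show ?thesis using en by linarith
    qed
    moreover have "\<psi> N / N\<^sup>2 * (1 - 80 * \<psi> N) \<le> \<psi> N / N\<^sup>2 * 1"
      using q by (intro mult_left_mono) auto
    ultimately show ?thesis using far unfolding N_def by linarith
  qed
qed

end

section \<open>Building the chain in blocks of four\<close>

definition link :: "(real \<Rightarrow> real) \<Rightarrow> ivec \<Rightarrow> ivec \<Rightarrow> ivec \<Rightarrow> ivec \<Rightarrow> bool" where
  "link \<psi> u v w z \<longleftrightarrow>
     det3 u v w = 1 \<and> 8 * (hgt u)\<^sup>2 \<le> crs u v \<and>
     4 * (crs v w)\<^sup>2 * hgt u \<le> hgt v * crs u v * crs w z \<and>
     (crs v w \<le> (hgt u)\<^sup>2 / (4 * \<psi> (hgt u)) \<or> hit \<psi> u v w z)"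

text \<open>The interface between blocks, required of the first three vectors and restored for the
  last three. The fourth condition says that the sine of the angle from \<open>u\<close> to
  \<open>v\<close> is at least 1/2.\<close>

definition ready :: "(real \<Rightarrow> real) \<Rightarrow> ivec \<Rightarrow> ivec \<Rightarrow> ivec \<Rightarrow> bool" where
  "ready \<psi> u v w \<longleftrightarrow>
     det3 u v w = 1 \<and> 1 \<le> hgt u \<and> 8 * (hgt u)\<^sup>2 \<le> crs u v \<and> hgt u * hgt v \<le> 2 * crs u v \<and>
     8 * (hgt v)\<^sup>2 \<le> crs v w \<and> hgt w \<le> 16 * hgt v \<and> crs v w \<le> (hgt u)\<^sup>2 / (4 * \<psi> (hgt u))"

text \<open>\<open>Q\<close> bounds the reciprocal sine of the angle from \<open>u\<close> to
  \<open>v\<close>; with \<open>crs v w \<le> hgt v * hgt w\<close> only a lower bound on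
  \<open>crs w z\<close> in terms of \<open>hgt w\<close> remains.\<close>

lemma spread_if:
  assumes "hgt u * hgt v \<le> Q * crs u v" "4 * Q * (hgt w)\<^sup>2 \<le> crs w z"
    and "0 < hgt v" "0 \<le> crs v w" "0 < crs u v" "0 \<le> Q"
  shows "4 * (crs v w)\<^sup>2 * hgt u \<le> hgt v * crs u v * crs w z"
proof -
  have c: "(crs v w)\<^sup>2 \<le> (hgt v * hgt w)\<^sup>2" using crs_le assms by (intro power_mono) auto
  have "hgt v * (4 * (crs v w)\<^sup>2 * hgt u) = 4 * (crs v w)\<^sup>2 * (hgt u * hgt v)" by simp
  also have "\<dots> \<le> 4 * (crs v w)\<^sup>2 * (Q * crs u v)" using assms by (intro mult_left_mono) auto
  also have "\<dots> \<le> 4 * (hgt v * hgt w)\<^sup>2 * (Q * crs u v)" using assms c by (intro mult_right_mono) auto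
  also have "\<dots> = ((hgt v)\<^sup>2 * crs u v) * (4 * Q * (hgt w)\<^sup>2)" by (simp add: power_mult_distrib)
  also have "\<dots> \<le> ((hgt v)\<^sup>2 * crs u v) * crs w z" using assms by (intro mult_left_mono) auto
  also have "\<dots> = hgt v * (hgt v * crs u v * crs w z)" by (simp add: power2_eq_square)
  finally show ?thesis using assms(3) by simp
qed

lemma hgt_ge_8:
  assumes "8 * (hgt u)\<^sup>2 \<le> crs u v" "0 < hgt u"
  shows "8 * hgt u \<le> hgt v"
proof -
  have "hgt u * (8 * hgt u) \<le> hgt u * hgt v"
    using assms(1) crs_le[of u v] by (simp add: power2_eq_square)
  thus ?thesis using assms(2) by simp
qed

text \<open>The default step when no particular cross product is wanted: the window starts at
  \<open>8 * (hgt w)\<^sup>2\<close> and its width \<open>crs v w\<close> is at most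
  \<open>(hgt w)\<^sup>2\<close>, so heights grow by a bounded factor.\<close>

lemma exists_next_8:
  assumes "det3 u v w = 1" "8 * (hgt v)\<^sup>2 \<le> crs v w" "0 < hgt v"
  obtains z where "det3 v w z = 1" "8 * (hgt w)\<^sup>2 \<le> crs w z" "crs w z \<le> 9 * (hgt w)\<^sup>2"
    "hgt z \<le> 16 * hgt w" "hgt w * hgt z \<le> 2 * crs w z" "\<bar>lin a b w\<bar> / 2 \<le> \<bar>lin a b z\<bar>"
proof -
  have vw: "8 * hgt v \<le> hgt w" by (rule hgt_ge_8[OF assms(2,3)])
  have c: "0 < crs v w" using assms(2,3) by (smt (verit) zero_less_power)
  have w: "0 < hgt w" using vw assms(3) by linarith
  obtain z where z: "det3 v w z = 1" "8 * (hgt w)\<^sup>2 \<le> crs w z" "crs w z < 8 * (hgt w)\<^sup>2 + crs v w"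
    "hgt w * hgt z \<le> crs w z + 2 * (hgt w)\<^sup>2" "\<bar>lin a b w\<bar> / 2 \<le> \<bar>lin a b z\<bar>"
    using exists_next[OF assms(1) c w, of "8 * (hgt w)\<^sup>2" a b] by auto
  have "crs v w \<le> hgt v * hgt w" by (rule crs_le)
  also have "\<dots> \<le> hgt w * hgt w" using vw assms(3) by (intro mult_right_mono) auto
  finally have u: "crs w z \<le> 9 * (hgt w)\<^sup>2" using z by (simp add: power2_eq_square)
  have "hgt w * hgt z \<le> hgt w * (16 * hgt w)"
    using z(4) u zero_le_power2[of "hgt w"] unfolding power2_eq_square mult.left_commute[of "hgt w" 16]
    by linarith
  hence "hgt z \<le> 16 * hgt w" using w by simp
  moreover have "hgt w * hgt z \<le> 2 * crs w z" using z(2,4) zero_le_power2[of "hgt w"] by linarith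
  ultimately show thesis using that[of z] z u by auto
qed

text \<open>The inverse cube root of a value of \<psi> is then at least \<open>10 ^ 18\<close> and
  absorbs the constants of the flat case. Arguments from 1 on suffice, as nonzero lattice vectors
  have norm at least 1.\<close>

locale small_psi =
  fixes \<psi> :: "real \<Rightarrow> real"
  assumes psi_pos: "\<And>x. 1 \<le> x \<Longrightarrow> 0 < \<psi> x"
    and psi_antimono: "\<And>x y. 1 \<le> x \<Longrightarrow> x \<le> y \<Longrightarrow> \<psi> y \<le> \<psi> x"
    and psi_small: "\<psi> 1 \<le> 1 / 10 ^ 54"
begin

lemma psi_le: "1 \<le> x \<Longrightarrow> \<psi> x \<le> 1 / 10 ^ 54"
  using psi_antimono[of 1 x] psi_small by linarith

lemma inverse_psi_ge: "1 \<le> x \<Longrightarrow> 10 ^ 54 \<le> 1 / \<psi> x"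
  using psi_le[of x] psi_pos[of x] by (simp add: field_simps)

lemma size_if_ratio_le_16:
  assumes "1 \<le> hgt u" "hgt v \<le> 16 * hgt u" "crs v w \<le> 9 * (hgt v)\<^sup>2"
  shows "crs v w \<le> (hgt u)\<^sup>2 / (4 * \<psi> (hgt u))"
proof -
  have "(hgt v)\<^sup>2 \<le> (16 * hgt u)\<^sup>2" using assms by (intro power_mono) auto
  hence "crs v w \<le> (hgt u)\<^sup>2 * 2304" using assms(3) by (simp add: power_mult_distrib)
  also have "\<dots> \<le> (hgt u)\<^sup>2 * (1 / (4 * \<psi> (hgt u)))"
    using inverse_psi_ge[OF assms(1)] by (intro mult_left_mono) auto
  finally show ?thesis by simp
qed

text \<open>The hit is at \<open>v1\<close>: as
  \<open>crs v1 v2 \<le> 16 * (hgt v1)\<^sup>2\<close>, a single step with target \<open>T\<close>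
  is accurate enough. It makes \<open>v3\<close> long, of order \<open>hgt v1 / q\<close>; steepness
  saves the size condition at \<open>v2\<close>. The other steps are default ones.\<close>

lemma extend_steep:
  assumes rdy: "ready \<psi> v0 v1 v2" and steep: "\<psi> (hgt v2) \<le> (\<psi> (hgt v1))\<^sup>2"
  obtains v3 v4 v5 v6 where
    "link \<psi> v0 v1 v2 v3" "link \<psi> v1 v2 v3 v4" "link \<psi> v2 v3 v4 v5" "link \<psi> v3 v4 v5 v6"
    "ready \<psi> v4 v5 v6" "hit \<psi> v1 v2 v3 v4" "\<bar>lin a b v5\<bar> / 2 \<le> \<bar>lin a b v6\<bar>"
proof -
  have det0: "det3 v0 v1 v2 = 1" and X0: "1 \<le> hgt v0" and g0: "8 * (hgt v0)\<^sup>2 \<le> crs v0 v1"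
    and o0: "hgt v0 * hgt v1 \<le> 2 * crs v0 v1" and g1: "8 * (hgt v1)\<^sup>2 \<le> crs v1 v2"
    and r1: "hgt v2 \<le> 16 * hgt v1" and s0: "crs v1 v2 \<le> (hgt v0)\<^sup>2 / (4 * \<psi> (hgt v0))"
    using rdy unfolding ready_def by auto
  have X01: "8 * hgt v0 \<le> hgt v1" using g0 X0 by (intro hgt_ge_8) auto
  have X1: "1 \<le> hgt v1" using X01 X0 by linarith
  have X12: "8 * hgt v1 \<le> hgt v2" using g1 X1 by (intro hgt_ge_8) auto
  have X2: "1 \<le> hgt v2" using X12 X1 by linarith
  define q where "q = \<psi> (hgt v1)"
  define T where "T = (hgt v1)\<^sup>2 / q"
  have q: "0 < q" using psi_pos X1 unfolding q_def by auto
  have q': "10000 \<le> 1 / q" using inverse_psi_ge[OF X1] unfolding q_def by (rule order_trans[rotated]) simp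
  have Tbig: "10000 * (hgt v1)\<^sup>2 \<le> T"
    using mult_right_mono[OF q', of "(hgt v1)\<^sup>2"] by (simp add: T_def)
  have S1: "1 \<le> (hgt v1)\<^sup>2" using X1 by simp
  have S2: "(hgt v2)\<^sup>2 \<le> 256 * (hgt v1)\<^sup>2"
    using power_mono[OF r1, of 2] by (simp add: power_mult_distrib)
  have d1: "crs v1 v2 \<le> 16 * (hgt v1)\<^sup>2"
  proof -
    have "hgt v1 * hgt v2 \<le> hgt v1 * (16 * hgt v1)" using r1 by (intro mult_left_mono) auto
    thus ?thesis using crs_le[of v1 v2] by (simp add: power2_eq_square)
  qed
  have o1: "hgt v1 * hgt v2 \<le> 2 * crs v1 v2"
  proof -
    have "hgt v1 * hgt v2 \<le> hgt v1 * (16 * hgt v1)" using r1 by (intro mult_left_mono) auto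
    thus ?thesis using g1 by (simp add: power2_eq_square)
  qed
  have c1: "0 < crs v1 v2" using g1 S1 by linarith
  have T0: "0 \<le> T" using Tbig S1 by linarith
  obtain v3 where det1: "det3 v1 v2 v3 = 1" and T2: "T \<le> crs v2 v3" and T2': "crs v2 v3 < T + crs v1 v2"
    and o2': "hgt v2 * hgt v3 \<le> crs v2 v3 + 2 * (hgt v2)\<^sup>2"
    using exists_next[OF det0 c1 _ T0] X2 by (metis less_le_trans zero_less_one)
  have g2: "8 * (hgt v2)\<^sup>2 \<le> crs v2 v3" using S2 Tbig T2 S1 by linarith
  have o2: "hgt v2 * hgt v3 \<le> 2 * crs v2 v3" using o2' g2 S2 Tbig T2 S1 by linarith
  have c2: "0 < crs v2 v3" using T2 Tbig S1 by linarith
  have X23: "8 * hgt v2 \<le> hgt v3" using g2 X2 by (intro hgt_ge_8) auto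
  have X3: "1 \<le> hgt v3" using X23 X2 by linarith
  obtain v4 where v4: "det3 v2 v3 v4 = 1" "8 * (hgt v3)\<^sup>2 \<le> crs v3 v4" "crs v3 v4 \<le> 9 * (hgt v3)\<^sup>2"
    "hgt v4 \<le> 16 * hgt v3" "hgt v3 * hgt v4 \<le> 2 * crs v3 v4"
    using exists_next_8[OF det1 g2] X2 by (metis less_le_trans zero_less_one)
  have X4: "1 \<le> hgt v4" using hgt_ge_8[OF v4(2)] X3 by linarith
  obtain v5 where v5: "det3 v3 v4 v5 = 1" "8 * (hgt v4)\<^sup>2 \<le> crs v4 v5" "crs v4 v5 \<le> 9 * (hgt v4)\<^sup>2"
    "hgt v5 \<le> 16 * hgt v4" "hgt v4 * hgt v5 \<le> 2 * crs v4 v5"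
    using exists_next_8[OF v4(1,2)] X3 by (metis less_le_trans zero_less_one)
  have X5: "1 \<le> hgt v5" using hgt_ge_8[OF v5(2)] X4 by linarith
  obtain v6 where v6: "det3 v4 v5 v6 = 1" "8 * (hgt v5)\<^sup>2 \<le> crs v5 v6" "crs v5 v6 \<le> 9 * (hgt v5)\<^sup>2"
    "hgt v6 \<le> 16 * hgt v5" "hgt v5 * hgt v6 \<le> 2 * crs v5 v6" "\<bar>lin a b v5\<bar> / 2 \<le> \<bar>lin a b v6\<bar>"
    using exists_next_8[OF v5(1,2), of a b] X4 by (metis less_le_trans zero_less_one)
  have pos: "0 < crs v0 v1" "0 < crs v3 v4" "0 < crs v4 v5"
    using g0 v4(2) v5(2) X0 X3 X4 by (smt (verit) one_le_power)+
  have h: "hit \<psi> v1 v2 v3 v4"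
  proof -
    have "T \<le> hgt v3 * (16 * hgt v1)"
      using T2 crs_le[of v2 v3] mult_right_mono[OF r1, of "hgt v3"] by (simp add: mult.commute)
    hence "hgt v1 * (hgt v1 / q) \<le> hgt v1 * (16 * hgt v3)" by (simp add: T_def power2_eq_square mult_ac)
    hence "hgt v1 / q \<le> 16 * hgt v3" by (rule mult_left_le_imp_le) (use X1 in linarith)
    moreover define s where "s = hgt v1 / q"
    ultimately have "hgt v3 * s \<le> hgt v3 * (16 * hgt v3)" by (intro mult_left_mono) auto
    hence "hgt v3 * s \<le> 32 * crs v3 v4"
      using v4(2) zero_le_power2[of "hgt v3"] unfolding power2_eq_square mult.left_commute[of "hgt v3" 16]
      by linarith
    hence "hgt v1 * hgt v3 / (32 * q) \<le> crs v3 v4" by (simp add: s_def mult.commute)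
    thus ?thesis using T2 T2' d1 unfolding hit_def by (simp add: T_def q_def)
  qed
  have size2: "crs v3 v4 \<le> (hgt v2)\<^sup>2 / (4 * \<psi> (hgt v2))"
  proof -
    let ?p = "\<psi> (hgt v2)"
    have p: "0 < ?p" "?p \<le> q\<^sup>2" using psi_pos X2 steep by (auto simp: q_def)
    have "hgt v2 * hgt v3 \<le> 4 * T" using o2 T2' d1 Tbig S1 by linarith
    hence "(hgt v2 * hgt v3)\<^sup>2 \<le> (4 * T)\<^sup>2" using X2 X3 by (intro power_mono) auto
    hence *: "(hgt v2 * hgt v3)\<^sup>2 \<le> 16 * T\<^sup>2" by (simp add: power_mult_distrib)
    have "(hgt v2)\<^sup>2 * (crs v3 v4 * (4 * ?p)) \<le> (hgt v2)\<^sup>2 * (9 * (hgt v3)\<^sup>2 * (4 * q\<^sup>2))"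
      using v4(3) p pos by (intro mult_left_mono mult_mono) auto
    also have "\<dots> = (hgt v2 * hgt v3)\<^sup>2 * (36 * q\<^sup>2)" by (simp add: power_mult_distrib)
    also have "\<dots> \<le> 16 * T\<^sup>2 * (36 * q\<^sup>2)" using * by (intro mult_right_mono) auto
    also have "\<dots> = 576 * (T * q)\<^sup>2" by (simp add: power_mult_distrib)
    also have "T * q = (hgt v1)\<^sup>2" using q by (simp add: T_def)
    also have "576 * ((hgt v1)\<^sup>2)\<^sup>2 \<le> (8 * hgt v1) ^ 4"
      by (simp add: power_mult_distrib flip: power_mult)
    also have "\<dots> \<le> hgt v2 ^ 4" using X12 by (intro power_mono) auto
    also have "\<dots> = (hgt v2)\<^sup>2 * (hgt v2)\<^sup>2" by (simp flip: power_add)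
    finally have "crs v3 v4 * (4 * ?p) \<le> (hgt v2)\<^sup>2"
      by (rule mult_left_le_imp_le) (use X2 in \<open>intro zero_less_power, linarith\<close>)
    thus ?thesis using p by (simp add: pos_le_divide_eq)
  qed
  have "link \<psi> v0 v1 v2 v3"
    unfolding link_def using det0 g0 s0 spread_if[OF o0, of v2 v3] g2 X1 c1 pos by auto
  moreover have "link \<psi> v1 v2 v3 v4"
    unfolding link_def using det1 g1 h spread_if[OF o1, of v3 v4] v4(2) X2 c1 c2 by auto
  moreover have "link \<psi> v2 v3 v4 v5"
    unfolding link_def using v4 g2 size2 spread_if[OF o2, of v4 v5] v5(2) X3 c2 pos by auto
  moreover have "link \<psi> v3 v4 v5 v6"
    unfolding link_def using v5 v4 size_if_ratio_le_16[of v3 v4 v5] spread_if[OF v4(5), of v5 v6] v6(2) X3 X4 pos by auto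
  moreover have "ready \<psi> v4 v5 v6"
    unfolding ready_def using v5 v6 X4 size_if_ratio_le_16[of v4 v5 v6] by auto
  ultimately show thesis using that h v6(6) by blast
qed

text \<open>The hit is at \<open>v2\<close>, with target \<open>r ^ 3 * (hgt v2)\<^sup>2\<close>.
  The heights of \<open>v3\<close>, \<open>v4\<close>, \<open>v5\<close> have orders
  \<open>r\<close>, \<open>r\<^sup>2\<close>, \<open>r ^ 3\<close> times \<open>hgt v2\<close>.
  Flatness enters in \<open>size1\<close>, where \<open>r\<close> must be small against
  \<open>1 / \<psi> (hgt v1)\<close>.\<close>

lemma extend_flat:
  assumes rdy: "ready \<psi> v0 v1 v2" and flat: "(\<psi> (hgt v1))\<^sup>2 \<le> \<psi> (hgt v2)"
  obtains v3 v4 v5 v6 where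
    "link \<psi> v0 v1 v2 v3" "link \<psi> v1 v2 v3 v4" "link \<psi> v2 v3 v4 v5" "link \<psi> v3 v4 v5 v6"
    "ready \<psi> v4 v5 v6" "hit \<psi> v2 v3 v4 v5" "\<bar>lin a b v5\<bar> / 2 \<le> \<bar>lin a b v6\<bar>"
proof -
  have det0: "det3 v0 v1 v2 = 1" and X0: "1 \<le> hgt v0" and g0: "8 * (hgt v0)\<^sup>2 \<le> crs v0 v1"
    and o0: "hgt v0 * hgt v1 \<le> 2 * crs v0 v1" and g1: "8 * (hgt v1)\<^sup>2 \<le> crs v1 v2"
    and r1: "hgt v2 \<le> 16 * hgt v1" and s0: "crs v1 v2 \<le> (hgt v0)\<^sup>2 / (4 * \<psi> (hgt v0))"
    using rdy unfolding ready_def by auto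
  have X01: "8 * hgt v0 \<le> hgt v1" using g0 X0 by (intro hgt_ge_8) auto
  have X1: "1 \<le> hgt v1" using X01 X0 by linarith
  have X12: "8 * hgt v1 \<le> hgt v2" using g1 X1 by (intro hgt_ge_8) auto
  have X2: "1 \<le> hgt v2" using X12 X1 by linarith
  define q where "q = \<psi> (hgt v2)"
  define r where "r = root 3 (1 / q)"
  have q: "0 < q" "10 ^ 54 \<le> 1 / q" using psi_pos inverse_psi_ge X2 unfolding q_def by auto
  have r3: "r ^ 3 = 1 / q" unfolding r_def using q by (intro real_root_pow_pos2) auto
  have r: "10 ^ 18 \<le> r"
  proof (rule power_le_imp_le_base)
    show "(10 ^ 18) ^ Suc 2 \<le> r ^ Suc 2" using q r3 by simp
    show "0 \<le> r" unfolding r_def using q by simp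
  qed
  have S2: "1 \<le> (hgt v2)\<^sup>2" "(hgt v2)\<^sup>2 \<le> 256 * (hgt v1)\<^sup>2"
    using X2 power_mono[OF r1, of 2] by (simp_all add: power_mult_distrib)
  have o1: "hgt v1 * hgt v2 \<le> 2 * crs v1 v2"
  proof -
    have "hgt v1 * hgt v2 \<le> hgt v1 * (16 * hgt v1)" using r1 by (intro mult_left_mono) auto
    thus ?thesis using g1 by (simp add: power2_eq_square)
  qed
  have d1: "(hgt v2)\<^sup>2 \<le> 32 * crs v1 v2" using S2 g1 by linarith
  have c1: "0 < crs v1 v2" using d1 S2 by linarith
  have d1': "crs v1 v2 \<le> (hgt v2)\<^sup>2"
  proof -
    have "hgt v1 * hgt v2 \<le> hgt v2 * hgt v2" using X12 X1 by (intro mult_right_mono) auto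
    thus ?thesis using crs_le[of v1 v2] by (simp add: power2_eq_square)
  qed
  \<comment> \<open>Two single steps would fix \<open>crs v3 v4\<close> only up to
    \<open>crs v2 v3\<close>, of order \<open>r * (hgt v2)\<^sup>2\<close>, whereas
    \<open>hit\<close> tolerates \<open>16 * (hgt v2)\<^sup>2\<close>.\<close>
  obtain v3 v4 where det1: "det3 v1 v2 v3 = 1" and det2: "det3 v2 v3 v4 = 1"
    and l2: "r * (hgt v2)\<^sup>2 \<le> crs v2 v3" and u2: "crs v2 v3 < r * (hgt v2)\<^sup>2 + crs v1 v2"
    and l3: "r ^ 3 * (hgt v2)\<^sup>2 \<le> crs v3 v4" and u3: "crs v3 v4 < r ^ 3 * (hgt v2)\<^sup>2 + crs v1 v2"
    and o2': "hgt v2 * hgt v3 \<le> crs v2 v3 + 2 * (hgt v2)\<^sup>2 + crs v2 v3 / crs v1 v2 * (hgt v2)\<^sup>2"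
    and o3': "hgt v3 * hgt v4 \<le> crs v3 v4 + 2 * (hgt v3)\<^sup>2"
  proof (rule exists_next2[OF det0 c1, of "r * (hgt v2)\<^sup>2" "r ^ 3 * (hgt v2)\<^sup>2"])
    show "0 < hgt v2" using X2 by linarith
    show "0 < r * (hgt v2)\<^sup>2" using r S2 by (intro mult_pos_pos) auto
    show "0 \<le> r ^ 3 * (hgt v2)\<^sup>2" using r by simp
  qed blast
  have r': "1000000 \<le> r" by (rule order_trans[OF _ r]) simp
  have r0: "0 < r" using r' by linarith
  have rS: "1000000 * (hgt v2)\<^sup>2 \<le> r * (hgt v2)\<^sup>2" using r' by (intro mult_right_mono) auto
  have c2: "0 < crs v2 v3" using l2 rS S2 by linarith
  have g2: "8 * (hgt v2)\<^sup>2 \<le> crs v2 v3" using l2 rS S2 by linarith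
  have X23: "8 * hgt v2 \<le> hgt v3" using g2 X2 by (intro hgt_ge_8) auto
  have X3: "1 \<le> hgt v3" using X23 X2 by linarith
  \<comment> \<open>The lengthening of \<open>y\<close> in \<open>exists_next2\<close> contributes
    32 by \<open>d1\<close>; the remaining terms fit into 2.\<close>
  have o2: "hgt v2 * hgt v3 \<le> 34 * crs v2 v3"
  proof -
    have "crs v2 v3 / crs v1 v2 * (hgt v2)\<^sup>2 \<le> crs v2 v3 / crs v1 v2 * (32 * crs v1 v2)"
      using d1 c1 c2 by (intro mult_left_mono) auto
    also have "\<dots> = 32 * crs v2 v3" using c1 by simp
    finally show ?thesis using o2' l2 rS S2 by linarith
  qed
  have d2: "crs v2 v3 \<le> 2 * (r * (hgt v2)\<^sup>2)" using u2 d1' rS S2 by linarith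
  have X3u: "hgt v3 \<le> 68 * (r * hgt v2)"
  proof -
    have "hgt v2 * hgt v3 \<le> hgt v2 * (68 * (r * hgt v2))"
      using o2 d2 by (simp add: power2_eq_square mult_ac)
    thus ?thesis using X2 by simp
  qed
  have X3l: "r * hgt v2 \<le> hgt v3"
  proof -
    have "hgt v2 * (r * hgt v2) \<le> hgt v2 * hgt v3"
      using l2 crs_le[of v2 v3] by (simp add: power2_eq_square mult_ac)
    thus ?thesis using X2 by simp
  qed
  have S3u: "(hgt v3)\<^sup>2 \<le> 4624 * (r\<^sup>2 * (hgt v2)\<^sup>2)"
    using power_mono[OF X3u, of 2] by (simp add: power_mult_distrib)
  have S3l: "r\<^sup>2 * (hgt v2)\<^sup>2 \<le> (hgt v3)\<^sup>2"
    using power_mono[OF X3l, of 2] r0 X2 by (simp add: power_mult_distrib)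
  have r3S: "1000000 * (r\<^sup>2 * (hgt v2)\<^sup>2) \<le> r ^ 3 * (hgt v2)\<^sup>2"
    using mult_right_mono[OF r', of "r\<^sup>2 * (hgt v2)\<^sup>2"] r0 by (simp add: power2_eq_square power3_eq_cube mult_ac)
  have r2S: "(hgt v2)\<^sup>2 \<le> r\<^sup>2 * (hgt v2)\<^sup>2"
    using mult_right_mono[of 1 "r\<^sup>2" "(hgt v2)\<^sup>2"] r' by simp
  have d3: "crs v3 v4 \<le> 2 * (r ^ 3 * (hgt v2)\<^sup>2)" using u3 d1' r3S r2S S2 by linarith
  have g3: "8 * (hgt v3)\<^sup>2 \<le> crs v3 v4" using S3u r3S r2S S2 l3 by linarith
  have c3: "0 < crs v3 v4" using l3 r3S r2S S2 by linarith
  have o3: "hgt v3 * hgt v4 \<le> 2 * crs v3 v4" using o3' g3 c3 by linarith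
  have X34: "8 * hgt v3 \<le> hgt v4" using g3 X3 by (intro hgt_ge_8) auto
  have X4: "1 \<le> hgt v4" using X34 X3 by linarith
  have X4u: "hgt v4 \<le> 4 * (r\<^sup>2 * hgt v2)"
  proof -
    have "(r * hgt v2) * hgt v4 \<le> hgt v3 * hgt v4" using X3l by (intro mult_right_mono) auto
    also have "\<dots> \<le> 4 * (r ^ 3 * (hgt v2)\<^sup>2)" using o3 d3 by linarith
    also have "\<dots> = (r * hgt v2) * (4 * (r\<^sup>2 * hgt v2))" by (simp add: power2_eq_square power3_eq_cube mult_ac)
    finally show ?thesis using r0 X2 by (simp add: mult_le_cancel_left_pos)
  qed
  have X4l: "r\<^sup>2 * hgt v2 \<le> 68 * hgt v4"
  proof -
    have "(r * hgt v2) * (r\<^sup>2 * hgt v2) = r ^ 3 * (hgt v2)\<^sup>2" by (simp add: power2_eq_square power3_eq_cube mult_ac)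
    also have "\<dots> \<le> hgt v3 * hgt v4" using l3 crs_le[of v3 v4] by linarith
    also have "\<dots> \<le> 68 * (r * hgt v2) * hgt v4" using X3u by (intro mult_right_mono) auto
    finally have "(r * hgt v2) * (r\<^sup>2 * hgt v2) \<le> (r * hgt v2) * (68 * hgt v4)" by (simp add: mult_ac)
    thus ?thesis using r0 X2 by (simp add: mult_le_cancel_left_pos)
  qed
  \<comment> \<open>\<open>D\<close> suffices for the last condition of \<open>hit\<close>, because
    \<open>hgt v2 * hgt v4 \<le> 4 * (hgt v3)\<^sup>2\<close>, and \<open>2 * D\<close> still obeys
    the size condition at \<open>v3\<close>; the window fits in between.\<close>
  define D where "D = r ^ 3 * (hgt v3)\<^sup>2 / 8"
  have D0: "0 \<le> D" unfolding D_def using r' by simp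
  obtain v5 where det3: "det3 v3 v4 v5 = 1" and l4: "D \<le> crs v4 v5" and u4: "crs v4 v5 < D + crs v3 v4"
    and o4': "hgt v4 * hgt v5 \<le> crs v4 v5 + 2 * (hgt v4)\<^sup>2"
    using exists_next[OF det2 c3 _ D0] X4 by (metis less_le_trans zero_less_one)
  have d4: "crs v4 v5 \<le> r ^ 3 * (hgt v3)\<^sup>2 / 4"
  proof -
    have "crs v3 v4 \<le> 2 * (r * (r\<^sup>2 * (hgt v2)\<^sup>2))" using d3 by (simp add: power2_eq_square power3_eq_cube mult_ac)
    also have "\<dots> \<le> 2 * (r * (hgt v3)\<^sup>2)" using S3l r0 by (intro mult_left_mono) auto
    also have "\<dots> \<le> D"
    proof -
      have "16 * r \<le> r ^ 3"
        using mult_mono[of 1000 r 1000 r] r' mult_right_mono[of 16 "r * r" r] by (simp add: power3_eq_cube)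
      hence "16 * r * (hgt v3)\<^sup>2 \<le> r ^ 3 * (hgt v3)\<^sup>2" by (intro mult_right_mono) auto
      thus ?thesis by (simp add: D_def)
    qed
    finally show ?thesis using u4 by (simp add: D_def)
  qed
  \<comment> \<open>136 is 4 * 34, as \<open>spread_if\<close> demands for
    \<open>Q = 34\<close>.\<close>
  have g4: "136 * (hgt v4)\<^sup>2 \<le> crs v4 v5"
  proof -
    have "(hgt v4)\<^sup>2 \<le> 16 * (r\<^sup>2 * (r\<^sup>2 * (hgt v2)\<^sup>2))"
      using power_mono[OF X4u, of 2] by (simp add: power_mult_distrib power2_eq_square mult_ac)
    also have "\<dots> \<le> 16 * (r\<^sup>2 * (hgt v3)\<^sup>2)" using S3l by (intro mult_left_mono) auto
    finally have "136 * (hgt v4)\<^sup>2 \<le> 17408 * (r\<^sup>2 * (hgt v3)\<^sup>2) / 8" by simp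
    also have "\<dots> \<le> D"
    proof -
      have "17408 * r\<^sup>2 \<le> r ^ 3"
        using mult_right_mono[of 17408 r "r\<^sup>2"] r' by (simp add: power3_eq_cube power2_eq_square)
      hence "17408 * r\<^sup>2 * (hgt v3)\<^sup>2 \<le> r ^ 3 * (hgt v3)\<^sup>2" by (intro mult_right_mono) auto
      thus ?thesis by (simp add: D_def)
    qed
    finally show ?thesis using l4 by linarith
  qed
  have S4: "1 \<le> (hgt v4)\<^sup>2" using X4 by simp
  have c4: "0 < crs v4 v5" using g4 S4 by linarith
  have g4': "8 * (hgt v4)\<^sup>2 \<le> crs v4 v5" using g4 S4 by linarith
  have o4: "hgt v4 * hgt v5 \<le> 2 * crs v4 v5" using o4' g4 S4 by linarith
  have X5: "1 \<le> hgt v5" using hgt_ge_8[OF g4'] X4 by linarith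
  obtain v6 where v6: "det3 v4 v5 v6 = 1" "8 * (hgt v5)\<^sup>2 \<le> crs v5 v6" "crs v5 v6 \<le> 9 * (hgt v5)\<^sup>2"
    "hgt v6 \<le> 16 * hgt v5" "hgt v5 * hgt v6 \<le> 2 * crs v5 v6" "\<bar>lin a b v5\<bar> / 2 \<le> \<bar>lin a b v6\<bar>"
    using exists_next_8[OF det3 g4', of a b] X4 by (metis less_le_trans zero_less_one)
  have c0: "0 < crs v0 v1" using g0 X0 by (smt (verit) one_le_power)
  have h: "hit \<psi> v2 v3 v4 v5"
  proof -
    have "hgt v2 * hgt v4 \<le> hgt v2 * (4 * (r\<^sup>2 * hgt v2))" using X4u by (intro mult_left_mono) auto
    also have "\<dots> = 4 * (r\<^sup>2 * (hgt v2)\<^sup>2)" by (simp add: power2_eq_square mult_ac)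
    finally have "hgt v2 * hgt v4 \<le> 4 * (hgt v3)\<^sup>2" using S3l by linarith
    hence "r ^ 3 * (hgt v2 * hgt v4) \<le> r ^ 3 * (4 * (hgt v3)\<^sup>2)" using r' by (intro mult_left_mono) auto
    hence "r ^ 3 * (hgt v2 * hgt v4) / 32 \<le> crs v4 v5" using l4 by (simp add: D_def)
    moreover have "r ^ 3 * (hgt v2 * hgt v4) / 32 = hgt v2 * hgt v4 / (32 * q)"
      unfolding r3 by simp
    moreover have "r ^ 3 * (hgt v2)\<^sup>2 = (hgt v2)\<^sup>2 / q" unfolding r3 by simp
    moreover have "crs v3 v4 \<le> r ^ 3 * (hgt v2)\<^sup>2 + 16 * (hgt v2)\<^sup>2" using u3 d1' S2 by linarith
    ultimately show ?thesis using l3 unfolding hit_def q_def[symmetric] by metis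
  qed
  have later: "r ^ 3 \<le> 1 / \<psi> y" if "hgt v2 \<le> y" for y
    using psi_antimono[OF X2 that] psi_pos[of y] X2 that q unfolding r3 q_def by (intro divide_left_mono) auto
  have size1: "crs v2 v3 \<le> (hgt v1)\<^sup>2 / (4 * \<psi> (hgt v1))"
  proof -
    let ?p = "\<psi> (hgt v1)"
    have p: "0 < ?p" "?p \<le> 1 / 10 ^ 54" "?p\<^sup>2 \<le> q" using psi_pos psi_le X1 flat by (auto simp: q_def)
    \<comment> \<open>Cubes are compared: flatness gives
      \<open>(r * ?p) ^ 3 = ?p ^ 3 / q \<le> ?p\<close>.\<close>
    have "2048 * (r * ?p) \<le> 1"
    proof (rule power_le_imp_le_base)
      have "r ^ 3 * ?p\<^sup>2 \<le> r ^ 3 * q" using p r0 by (intro mult_left_mono) auto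
      hence "r ^ 3 * ?p\<^sup>2 \<le> 1" using r3 q by simp
      hence "r ^ 3 * ?p\<^sup>2 * ?p \<le> 1 * ?p" using p by (intro mult_right_mono) auto
      hence "(r * ?p) ^ 3 \<le> ?p" by (simp add: power_mult_distrib power3_eq_cube power2_eq_square mult_ac)
      thus "(2048 * (r * ?p)) ^ Suc 2 \<le> 1 ^ Suc 2" using p by (simp add: power_mult_distrib[of 2048])
    qed simp
    hence "(hgt v1)\<^sup>2 * (2048 * (r * ?p)) \<le> (hgt v1)\<^sup>2 * 1" by (intro mult_left_mono) auto
    hence "(512 * (r * (hgt v1)\<^sup>2)) * (4 * ?p) \<le> (hgt v1)\<^sup>2" by (simp add: mult_ac)
    hence "512 * (r * (hgt v1)\<^sup>2) \<le> (hgt v1)\<^sup>2 / (4 * ?p)" using p by (simp add: pos_le_divide_eq)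
    moreover have "r * (hgt v2)\<^sup>2 \<le> r * (256 * (hgt v1)\<^sup>2)" using S2 r0 by (intro mult_left_mono) auto
    ultimately show ?thesis using d2 by linarith
  qed
  have size3: "crs v4 v5 \<le> (hgt v3)\<^sup>2 / (4 * \<psi> (hgt v3))"
  proof -
    have "r ^ 3 * (hgt v3)\<^sup>2 \<le> 1 / \<psi> (hgt v3) * (hgt v3)\<^sup>2"
      using X23 X2 by (intro mult_right_mono later) auto
    thus ?thesis using d4 by simp
  qed
  have size4: "crs v5 v6 \<le> (hgt v4)\<^sup>2 / (4 * \<psi> (hgt v4))"
  proof -
    have X3': "r * hgt v3 \<le> 4624 * hgt v4"
    proof -
      have "r * hgt v3 \<le> r * (68 * (r * hgt v2))" using X3u r0 by (intro mult_left_mono) auto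
      thus ?thesis using X4l by (simp add: power2_eq_square mult_ac)
    qed
    have "hgt v4 * hgt v5 \<le> r ^ 3 * (hgt v3)\<^sup>2 / 2" using o4 d4 by linarith
    also have "\<dots> = r * (r * hgt v3)\<^sup>2 / 2" by (simp add: power2_eq_square power3_eq_cube)
    also have "\<dots> \<le> r * (4624 * hgt v4)\<^sup>2 / 2"
      using X3' r0 X3 by (intro divide_right_mono mult_left_mono power_mono) auto
    also have "\<dots> = hgt v4 * (10690688 * (r * hgt v4))" by (simp add: power2_eq_square)
    finally have "hgt v5 \<le> 10690688 * (r * hgt v4)" using X4 by simp
    hence "(hgt v5)\<^sup>2 \<le> (10690688 * (r * hgt v4))\<^sup>2" using X5 by (intro power_mono) auto
    hence "36 * (hgt v5)\<^sup>2 \<le> 36 * 10690688\<^sup>2 * (r\<^sup>2 * (hgt v4)\<^sup>2)" by (simp add: power_mult_distrib)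
    \<comment> \<open>The numerical factor is about 4 * 10^15, beyond the bound \<open>r'\<close>;
      here the bound \<open>10 ^ 18\<close> on \<open>r\<close> is called upon.\<close>
    also have "\<dots> \<le> r * (r\<^sup>2 * (hgt v4)\<^sup>2)"
      by (intro mult_right_mono order_trans[OF _ r]) simp_all
    also have "\<dots> = r ^ 3 * (hgt v4)\<^sup>2" by (simp add: power2_eq_square power3_eq_cube)
    also have "\<dots> \<le> 1 / \<psi> (hgt v4) * (hgt v4)\<^sup>2"
      using X34 X23 X2 by (intro mult_right_mono later) auto
    finally show ?thesis using v6(3) by simp
  qed
  have "link \<psi> v0 v1 v2 v3"
    unfolding link_def using det0 g0 s0 spread_if[OF o0, of v2 v3] g2 X1 c1 c0 by auto
  moreover have "link \<psi> v1 v2 v3 v4"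
    unfolding link_def using det1 g1 size1 spread_if[OF o1, of v3 v4] g3 X2 c1 c2 by auto
  moreover have "link \<psi> v2 v3 v4 v5"
    unfolding link_def using det2 g2 h spread_if[OF o2, of v4 v5] g4 X3 c2 c3 by auto
  moreover have "link \<psi> v3 v4 v5 v6"
    unfolding link_def using det3 g3 size3 spread_if[OF o3, of v5 v6] v6(2) X4 c3 c4 by auto
  moreover have "ready \<psi> v4 v5 v6"
    unfolding ready_def using v6 X4 g4' o4 size4 by auto
  ultimately show thesis using that h v6(6) by blast
qed

end

section \<open>The infinite chain and a good point off a given sequence\<close>

context small_psi
begin

text \<open>Blocks of seven vectors overlap in three and are glued by dependent choice. Each
  supplies one hit and one inequality at its own prescribed point.\<close>

lemma exists_chain:
  fixes a b :: "nat \<Rightarrow> real"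
  obtains v :: "nat \<Rightarrow> ivec" where
    "v 0 = (0, 1, 0)" "v 1 = (1, 0, 8)" "v 2 = (0, -64, -1)"
    "\<And>n. link \<psi> (v n) (v (Suc n)) (v (Suc (Suc n))) (v (Suc (Suc (Suc n))))"
    "\<And>k. \<exists>n\<ge>k. hit \<psi> (v n) (v (Suc n)) (v (Suc (Suc n))) (v (Suc (Suc (Suc n))))"
    "\<And>k. \<bar>lin (a k) (b k) (v (4 * k + 5))\<bar> / 2 \<le> \<bar>lin (a k) (b k) (v (Suc (4 * k + 5)))\<bar>"
proof -
  define block where "block k t \<longleftrightarrow>
      link \<psi> (t 0) (t 1) (t 2) (t 3) \<and> link \<psi> (t 1) (t 2) (t 3) (t 4) \<and>
      link \<psi> (t 2) (t 3) (t 4) (t 5) \<and> link \<psi> (t 3) (t 4) (t 5) (t 6) \<and>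
      ready \<psi> (t 4) (t 5) (t 6) \<and>
      (hit \<psi> (t 1) (t 2) (t 3) (t 4) \<or> hit \<psi> (t 2) (t 3) (t 4) (t 5)) \<and>
      \<bar>lin (a k) (b k) (t 5)\<bar> / 2 \<le> \<bar>lin (a k) (b k) (t 6)\<bar>" for k and t :: "nat \<Rightarrow> ivec"
  have extend: "\<exists>t. block k t \<and> t 0 = v0 \<and> t 1 = v1 \<and> t 2 = v2" if "ready \<psi> v0 v1 v2" for v0 v1 v2 k
  proof -
    have "\<exists>v3 v4 v5 v6. link \<psi> v0 v1 v2 v3 \<and> link \<psi> v1 v2 v3 v4 \<and> link \<psi> v2 v3 v4 v5 \<and> link \<psi> v3 v4 v5 v6 \<and>
        ready \<psi> v4 v5 v6 \<and> (hit \<psi> v1 v2 v3 v4 \<or> hit \<psi> v2 v3 v4 v5) \<and>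
        \<bar>lin (a k) (b k) v5\<bar> / 2 \<le> \<bar>lin (a k) (b k) v6\<bar>"
    proof (cases "\<psi> (hgt v2) \<le> (\<psi> (hgt v1))\<^sup>2")
      case True
      show ?thesis by (rule extend_steep[OF that True, of "a k" "b k"]) blast
    next
      case False
      hence flat: "(\<psi> (hgt v1))\<^sup>2 \<le> \<psi> (hgt v2)" by linarith
      show ?thesis by (rule extend_flat[OF that flat, of "a k" "b k"]) blast
    qed
    then obtain v3 v4 v5 v6 where e: "link \<psi> v0 v1 v2 v3 \<and> link \<psi> v1 v2 v3 v4 \<and> link \<psi> v2 v3 v4 v5 \<and> link \<psi> v3 v4 v5 v6 \<and>
        ready \<psi> v4 v5 v6 \<and> (hit \<psi> v1 v2 v3 v4 \<or> hit \<psi> v2 v3 v4 v5) \<and>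
        \<bar>lin (a k) (b k) v5\<bar> / 2 \<le> \<bar>lin (a k) (b k) v6\<bar>" by blast
    define t where "t i = [v0, v1, v2, v3, v4, v5, v6] ! i" for i
    have "t 0 = v0" "t 1 = v1" "t 2 = v2" "t 3 = v3" "t 4 = v4" "t 5 = v5" "t 6 = v6"
      by (simp_all add: t_def)
    thus ?thesis using e unfolding block_def by (intro exI[of _ t]) simp
  qed
  \<comment> \<open>Heights are 1, 8 and \<open>sqrt 4097\<close>; the cross products 8 and 512 are
    the least that the growth conditions permit.\<close>
  have init: "ready \<psi> (0, 1, 0) (1, 0, 8) (0, -64, -1)"
  proof -
    have "sqrt 4097 \<le> (128::real)" by (rule real_le_lsqrt) auto
    moreover have "512 \<le> 1 / (4 * \<psi> 1)" using inverse_psi_ge[of 1] by simp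
    ultimately show ?thesis unfolding ready_def by simp
  qed
  define initial where "initial t \<longleftrightarrow> t 0 = (0, 1, 0) \<and> t 1 = (1, 0, 8) \<and> t 2 = (0, -64, -1)" for t :: "nat \<Rightarrow> ivec"
  define follows where "follows s t \<longleftrightarrow> t 0 = s 4 \<and> t 1 = s 5 \<and> t 2 = s 6" for s t :: "nat \<Rightarrow> ivec"
  have "\<exists>f. \<forall>k. (block k (f k) \<and> (k = 0 \<longrightarrow> initial (f k))) \<and> follows (f k) (f (Suc k))"
  proof (rule dependent_nat_choice[of "\<lambda>k t. block k t \<and> (k = 0 \<longrightarrow> initial t)" "\<lambda>k. follows"])
    show "\<exists>t. block 0 t \<and> (0 = (0::nat) \<longrightarrow> initial t)"
      using extend[OF init, of 0] unfolding initial_def by blast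
  next
    fix s :: "nat \<Rightarrow> ivec" and k :: nat
    assume "block k s \<and> (k = 0 \<longrightarrow> initial s)"
    hence "ready \<psi> (s 4) (s 5) (s 6)" by (simp add: block_def)
    from extend[OF this, of "Suc k"]
    show "\<exists>t. (block (Suc k) t \<and> (Suc k = 0 \<longrightarrow> initial t)) \<and> follows s t"
      unfolding follows_def by blast
  qed
  then obtain f where f: "\<forall>k. block k (f k) \<and> (k = 0 \<longrightarrow> initial (f k))" "\<forall>k. follows (f k) (f (Suc k))"
    by blast
  have blk: "block k (f k)" for k using f(1) by blast
  have f0: "f 0 0 = (0, 1, 0)" "f 0 1 = (1, 0, 8)" "f 0 2 = (0, -64, -1)"
    using f(1) unfolding initial_def by blast+
  have step: "f (Suc k) 0 = f k 4" "f (Suc k) 1 = f k 5" "f (Suc k) 2 = f k 6" for k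
    using f(2) unfolding follows_def by blast+
  \<comment> \<open>Only entries 0 to 3 of a block are read; entries 4 to 6 reappear as entries 0 to
    2 of the next one.\<close>
  define v where "v n = f (n div 4) (n mod 4)" for n
  have vj: "v (4 * k + j) = f k j" if "j < 4" for j k using that by (simp add: v_def)
  have vk: "v (4 * k) = f k 0" "v (4 * k + 1) = f k 1" "v (4 * k + 2) = f k 2" "v (4 * k + 3) = f k 3" for k
    using vj[of 0 k] vj[of 1 k] vj[of 2 k] vj[of 3 k] by simp_all
  have vk': "v (4 * k + 4) = f k 4" "v (4 * k + 5) = f k 5" "v (4 * k + 6) = f k 6" for k
  proof -
    have "4 * k + 4 = 4 * Suc k" "4 * k + 5 = 4 * Suc k + 1" "4 * k + 6 = 4 * Suc k + 2" by simp_all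
    thus "v (4 * k + 4) = f k 4" "v (4 * k + 5) = f k 5" "v (4 * k + 6) = f k 6"
      using vk(1-3)[of "Suc k"] step[of k] by metis+
  qed
  have vj': "v (4 * k + j) = f k j" if "j < 7" for j k
  proof -
    have "j < 4 \<or> j = 4 \<or> j = 5 \<or> j = 6" using that by linarith
    thus ?thesis using vj vk' by blast
  qed
  have links: "link \<psi> (v n) (v (n + 1)) (v (n + 2)) (v (n + 3))" for n
  proof -
    define k j where "k = n div 4" and "j = n mod 4"
    have n: "n = 4 * k + j" "j < 4" unfolding k_def j_def by simp_all
    have "j = 0 \<or> j = 1 \<or> j = 2 \<or> j = 3" using n(2) by linarith
    hence "link \<psi> (f k j) (f k (j + 1)) (f k (j + 2)) (f k (j + 3))"
      using blk[of k] unfolding block_def by (elim disjE) (simp_all add: numeral_eq_Suc)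
    thus ?thesis using n(2) unfolding n(1) add.assoc by (subst (1 2 3 4) vj') auto
  qed
  have hits: "\<exists>n\<ge>k. hit \<psi> (v n) (v (n + 1)) (v (n + 2)) (v (n + 3))" for k
  proof -
    obtain j where j: "j = 1 \<or> j = 2" "hit \<psi> (f k j) (f k (j + 1)) (f k (j + 2)) (f k (j + 3))"
    proof -
      have "hit \<psi> (f k 1) (f k (1 + 1)) (f k (1 + 2)) (f k (1 + 3))
          \<or> hit \<psi> (f k 2) (f k (2 + 1)) (f k (2 + 2)) (f k (2 + 3))"
        using blk[of k] unfolding block_def by (simp add: numeral_eq_Suc)
      thus thesis using that by blast
    qed
    have "hit \<psi> (v (4 * k + j)) (v (4 * k + j + 1)) (v (4 * k + j + 2)) (v (4 * k + j + 3))"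
      using j unfolding add.assoc by (subst (1 2 3 4) vj') auto
    thus ?thesis by (intro exI[of _ "4 * k + j"]) simp
  qed
  show thesis
  proof (rule that[of v])
    show "v 0 = (0, 1, 0)" "v 1 = (1, 0, 8)" "v 2 = (0, - 64, - 1)"
      using vk(1-3)[of 0] f0 by (simp_all add: numeral_2_eq_2)
    have suc: "n + 1 = Suc n" "n + 2 = Suc (Suc n)" "n + 3 = Suc (Suc (Suc n))" for n by simp_all
    show "link \<psi> (v n) (v (Suc n)) (v (Suc (Suc n))) (v (Suc (Suc (Suc n))))" for n
      using links[of n] unfolding suc .
    show "\<exists>n\<ge>k. hit \<psi> (v n) (v (Suc n)) (v (Suc (Suc n))) (v (Suc (Suc (Suc n))))" for k
      using hits[of k] unfolding suc .
    have "4 * k + 6 = Suc (4 * k + 5)" for k :: nat by simp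
    thus "\<bar>lin (a k) (b k) (v (4 * k + 5))\<bar> / 2 \<le> \<bar>lin (a k) (b k) (v (Suc (4 * k + 5)))\<bar>" for k
      using blk[of k] unfolding block_def vk'[symmetric] by metis
  qed
qed

text \<open>A diagonal argument: from \<open>v (4 * k + 5)\<close> to its successor the value drops
  below one half at \<alpha>, by \<open>e_Suc\<close>, whereas block \<open>k\<close> was chosen so
  that at \<open>\<beta> k\<close> it does not.\<close>

lemma exists_good_point:
  fixes \<beta> :: "nat \<Rightarrow> real ^ 2"
  obtains \<alpha> :: "real ^ 2" where "\<alpha> \<notin> range \<beta>"
    "\<And>x. x \<in> int_lattice2 - {0} \<Longrightarrow>
       \<psi> (norm x) / (norm x)\<^sup>2 * (1 - 80 * \<psi> (norm x)) \<le> dist_nearest_int (\<alpha> \<bullet> x)"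
    "infinite {x \<in> int_lattice2 - {0}.
       dist_nearest_int (\<alpha> \<bullet> x) \<le> \<psi> (norm x) / (norm x)\<^sup>2 * (1 + 80 * \<psi> (norm x))}"
proof -
  obtain v where v012: "v 0 = (0, 1, 0)" "v 1 = (1, 0, 8)" "v 2 = (0, -64, -1)"
    and links: "\<And>n. link \<psi> (v n) (v (Suc n)) (v (Suc (Suc n))) (v (Suc (Suc (Suc n))))"
    and hits: "\<And>k. \<exists>n\<ge>k. hit \<psi> (v n) (v (Suc n)) (v (Suc (Suc n))) (v (Suc (Suc (Suc n))))"
    and avoid: "\<And>k. \<bar>lin (\<beta> k $ 1) (\<beta> k $ 2) (v (4 * k + 5))\<bar> / 2 \<le> \<bar>lin (\<beta> k $ 1) (\<beta> k $ 2) (v (Suc (4 * k + 5)))\<bar>"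
    by (rule exists_chain[of "\<lambda>k. \<beta> k $ 1" "\<lambda>k. \<beta> k $ 2"]) blast
  note L = links[unfolded link_def]
  interpret lattice_chain v
  proof
    show "det3 (v n) (v (Suc n)) (v (Suc (Suc n))) = 1" for n using L[of n] by blast
    show "8 * (hgt (v n))\<^sup>2 \<le> crs (v n) (v (Suc n))" for n using L[of n] by blast
    show "1 \<le> hgt (v 0)" by (simp add: v012)
  qed
  obtain a b where ab: "\<And>n. \<bar>lin a b (v n) - 1 / d (Suc n)\<bar>
     \<le> 2 * X n * X (Suc (Suc n)) / (d (Suc n) * d (Suc (Suc n)))"
    using exists_limit_point by blast
  interpret spread_chain v \<psi> a b
  proof
    show "\<psi> 1 \<le> 1 / 1000" using psi_small by (rule order_trans) simp
    show "X 0 = 1" by (simp add: v012)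
    have "512 \<le> 1 / (4 * \<psi> 1)" using inverse_psi_ge[of 1] by simp
    thus "d 1 \<le> 1 / (4 * \<psi> 1)" using v012 by (simp add: numeral_2_eq_2)
    show "4 * (d (Suc n))\<^sup>2 * X n \<le> X (Suc n) * d n * d (Suc (Suc n))" for n using L[of n] by blast
    show "d (Suc n) \<le> (X n)\<^sup>2 / (4 * \<psi> (X n))
        \<or> hit \<psi> (v n) (v (Suc n)) (v (Suc (Suc n))) (v (Suc (Suc (Suc n))))" for n using L[of n] by blast
  qed (fact psi_pos psi_antimono ab)+
  define \<alpha> :: "real ^ 2" where "\<alpha> = vector [a, b]"
  have \<alpha>: "\<alpha> $ 1 = a" "\<alpha> $ 2 = b" by (simp_all add: \<alpha>_def)
  have inner2: "\<alpha> \<bullet> x = a * x $ 1 + b * x $ 2" for x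
    by (simp add: inner_vec_def sum_2 \<alpha>)
  have norm2: "norm x = sqrt ((x $ 1)\<^sup>2 + (x $ 2)\<^sup>2)" for x :: "real ^ 2"
    by (simp add: norm_vec_def L2_set_def sum_2)
  have "\<alpha> \<noteq> \<beta> k" for k
  proof
    assume "\<alpha> = \<beta> k"
    hence "e (4 * k + 5) / 2 \<le> e (Suc (4 * k + 5))"
      using avoid[of k] \<alpha> abs_of_pos[OF e_pos] by simp
    thus False using e_Suc[of "4 * k + 5"] by linarith
  qed
  hence notin: "\<alpha> \<notin> range \<beta>" by blast
  have lower: "\<psi> (norm x) / (norm x)\<^sup>2 * (1 - 80 * \<psi> (norm x)) \<le> dist_nearest_int (\<alpha> \<bullet> x)"
    if x: "x \<in> int_lattice2 - {0}" for x
  proof -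
    obtain p q where pq: "x $ 1 = of_int p" "x $ 2 = of_int q"
      using x unfolding int_lattice2_def Ints_def by (metis (mono_tags, lifting) DiffD1 imageE mem_Collect_eq)
    \<comment> \<open>With the negated nearest integer as constant term,
      \<open>\<bar>lin a b m\<bar>\<close> is the distance in question.\<close>
    define m :: ivec where "m = (- round (\<alpha> \<bullet> x), p, q)"
    have hm: "hgt m = norm x" by (simp add: m_def norm2 pq)
    have "p \<noteq> 0 \<or> q \<noteq> 0"
    proof (rule ccontr)
      assume "\<not> (p \<noteq> 0 \<or> q \<noteq> 0)"
      hence "x = 0" by (simp add: vec_eq_iff forall_2 pq)
      thus False using x by simp
    qed
    hence "1 \<le> p\<^sup>2 + q\<^sup>2" by (smt (verit) zero_le_power2 zero_eq_power2 sum_power2_gt_zero_iff)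
    hence "1 \<le> real_of_int (p\<^sup>2 + q\<^sup>2)" by linarith
    hence "1 \<le> hgt m" by (simp add: m_def)
    from lower_bound[OF this] show ?thesis
      by (simp add: hm) (simp add: m_def dist_nearest_int_def dist_real_def inner2 pq algebra_simps)
  qed
  have upper: "infinite {x \<in> int_lattice2 - {0}.
       dist_nearest_int (\<alpha> \<bullet> x) \<le> \<psi> (norm x) / (norm x)\<^sup>2 * (1 + 80 * \<psi> (norm x))}" (is "infinite ?U")
  proof
    assume "finite ?U"
    then obtain M where M: "\<And>x. x \<in> ?U \<Longrightarrow> norm x \<le> M"
      using finite_imp_bounded[of ?U] unfolding bounded_iff by blast
    obtain k :: nat where k: "M < k" using reals_Archimedean2 by blast
    obtain n where n: "n \<ge> k" "hit \<psi> (v n) (v (Suc n)) (v (Suc (Suc n))) (v (Suc (Suc (Suc n))))"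
      using hits[of k] by blast
    obtain y p p' where vn: "v n = (y, p, p')" by (cases "v n")
    define x :: "real ^ 2" where "x = vector [of_int p, of_int p']"
    have x: "x $ 1 = of_int p" "x $ 2 = of_int p'" by (simp_all add: x_def)
    have nx: "norm x = X n" by (simp add: norm2 x vn)
    have "x \<in> int_lattice2" by (simp add: int_lattice2_def forall_2 x)
    moreover have "x \<noteq> 0" using nx by (metis X_neq_0 norm_zero)
    moreover have "dist_nearest_int (\<alpha> \<bullet> x) \<le> \<psi> (norm x) / (norm x)\<^sup>2 * (1 + 80 * \<psi> (norm x))"
    proof -
      have "dist_nearest_int (\<alpha> \<bullet> x) \<le> dist (\<alpha> \<bullet> x) (of_int (- y))" by (rule dist_nearest_int_le)
      also have "\<dots> = \<bar>e n\<bar>" by (simp add: dist_real_def inner2 x vn algebra_simps)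
      also have "\<dots> = e n" by simp
      also have "\<dots> \<le> q n / (X n)\<^sup>2 * (1 + 80 * q n)" by (rule hit_upper[OF n(2)])
      finally show ?thesis unfolding nx .
    qed
    ultimately have "X n \<le> M" using M[of x] nx by simp
    thus False using X_ge_index[of n] k n(1) by linarith
  qed
  show thesis using that notin lower upper by blast
qed

end

theorem theorem4:
  "\<exists>A B :: real. A > 0 \<and> B > 0 \<and>
    (\<forall>\<psi> :: real \<Rightarrow> real.
      \<psi> \<in> {0<..} \<rightarrow> {0<..} \<longrightarrow> antimono_on {0<..} \<psi> \<longrightarrow> \<psi> 1 \<le> A \<longrightarrow>
      (\<exists>S :: (real ^ 2) set. uncountable S \<and>
        (\<forall>\<alpha>\<in>S.
          (\<forall>x\<in>int_lattice2 - {0}.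
             dist_nearest_int (\<alpha> \<bullet> x) \<ge> \<psi> (norm x) / (norm x)\<^sup>2 * (1 - B * \<psi> (norm x))) \<and>
          infinite {x \<in> int_lattice2 - {0}.
             dist_nearest_int (\<alpha> \<bullet> x) \<le> \<psi> (norm x) / (norm x)\<^sup>2 * (1 + B * \<psi> (norm x))})))"
proof (rule exI[of _ "1 / 10 ^ 54"], rule exI[of _ 80], intro conjI allI impI)
  fix \<psi> :: "real \<Rightarrow> real"
  assume pos: "\<psi> \<in> {0<..} \<rightarrow> {0<..}" and anti: "antimono_on {0<..} \<psi>" and small: "\<psi> 1 \<le> 1 / 10 ^ 54"
  interpret small_psi \<psi>
  proof
    show "0 < \<psi> x" if "1 \<le> x" for x using that Pi_mem[OF pos, of x] by simp
    show "\<psi> y \<le> \<psi> x" if "1 \<le> x" "x \<le> y" for x y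
      using that by (intro monotone_onD[OF anti]) auto
  qed (rule small)
  define S where "S = {\<alpha> :: real ^ 2. (\<forall>x\<in>int_lattice2 - {0}.
      dist_nearest_int (\<alpha> \<bullet> x) \<ge> \<psi> (norm x) / (norm x)\<^sup>2 * (1 - 80 * \<psi> (norm x))) \<and>
    infinite {x \<in> int_lattice2 - {0}.
      dist_nearest_int (\<alpha> \<bullet> x) \<le> \<psi> (norm x) / (norm x)\<^sup>2 * (1 + 80 * \<psi> (norm x))}}"
  have "uncountable S"
  proof
    assume "countable S"
    \<comment> \<open>Inclusion in a range, rather than equality, also covers an empty
      \<open>S\<close>; the point found off this range contradicts it.\<close>
    then obtain \<beta> :: "nat \<Rightarrow> real ^ 2" where \<beta>: "S \<subseteq> range \<beta>"
      by (metis empty_subsetI order_refl range_from_nat_into)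
    show False
    proof (rule exists_good_point[of \<beta>])
      fix \<alpha> :: "real ^ 2"
      assume "\<alpha> \<notin> range \<beta>"
        and "\<And>x. x \<in> int_lattice2 - {0} \<Longrightarrow>
          \<psi> (norm x) / (norm x)\<^sup>2 * (1 - 80 * \<psi> (norm x)) \<le> dist_nearest_int (\<alpha> \<bullet> x)"
        and "infinite {x \<in> int_lattice2 - {0}.
          dist_nearest_int (\<alpha> \<bullet> x) \<le> \<psi> (norm x) / (norm x)\<^sup>2 * (1 + 80 * \<psi> (norm x))}"
      hence "\<alpha> \<in> S" unfolding S_def by simp
      thus False using \<beta> \<open>\<alpha> \<notin> range \<beta>\<close> by blast
    qed
  qed
  thus "\<exists>S :: (real ^ 2) set. uncountable S \<and>
        (\<forall>\<alpha>\<in>S.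
          (\<forall>x\<in>int_lattice2 - {0}.
             dist_nearest_int (\<alpha> \<bullet> x) \<ge> \<psi> (norm x) / (norm x)\<^sup>2 * (1 - 80 * \<psi> (norm x))) \<and>
          infinite {x \<in> int_lattice2 - {0}.
             dist_nearest_int (\<alpha> \<bullet> x) \<le> \<psi> (norm x) / (norm x)\<^sup>2 * (1 + 80 * \<psi> (norm x))})"
    unfolding S_def by blast
qed auto

end
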